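(* Let $n\ge 3$, $\alpha\in[0,1)$, and let $T$ be a tree that has the maximum $A_\alpha$-index among all trees of order $n$ with dissociation number $\tau$. Then $\lambda_\alpha(T)\le\theta(\alpha,n,\tau)$, with equality if and only if $T\cong S^\dagger_{n,\tau}$, where $\theta(\alpha,n,\tau)$ is the largest zero of $$\begin{aligned}P_\alpha(x)={}&x^4+\alpha(n-2\tau-6)x^3+(8\alpha^2\tau-4\alpha^2n+4\alpha\tau-2\alpha n-2\tau+n+9\alpha^2+6\alpha-3)x^2\\&+\alpha(16\alpha n-\alpha^2n-8n-28\alpha\tau+14\tau-20\alpha+10)x+2\alpha^3n-17\alpha^2n+16\alpha n-4n\\&+24\alpha^2\tau-24\alpha\tau+6\tau-2\alpha^3+17\alpha^2-16\alpha+4.\end{aligned}$$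
   Context: All graphs are simple and finite. For a graph $G$ with adjacency matrix $A(G)$ and diagonal degree matrix $D(G)$, and $\alpha\in[0,1]$, let $A_\alpha(G)=\alpha D(G)+(1-\alpha)A(G)$; its largest eigenvalue $\lambda_\alpha(G)$ is the $A_\alpha$-index of $G$. A set $S\subseteq V(G)$ is a dissociation set if $G[S]$ has maximum degree at most $1$; the dissociation number is the maximum size of a dissociation set. $S_k=K_{1,k-1}$ denotes the star on $k$ vertices; its vertex of degree $k-1$ is its centre. $S^\dagger_{n,\tau}$ is the tree obtained from the star $S_{n-\tau}$ by attaching exactly two pendant edges to each leaf of $S_{n-\tau}$ and attaching $3\tau-2n+2$ pendant edges to the centre of $S_{n-\tau}$ (it has order $n$ and dissociation number $\tau$).
   Formalization: The equality characterization is not claimed for n = 3 with α > 0, where it is false: the only tree is the path on three vertices, isomorphic to S†_{3,2}, but its index is strictly less than θ; the bound λ ≤ θ is kept there. *)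

theory Defs
  imports
    "Graph_Theory.Graph_Theory"
    "Jordan_Normal_Form.Char_Poly"
begin

text \<open>
  A finite simple graph is a \<open>pair_graph\<close>: a finite, loop-free, symmetric set of pairs,
  each edge being represented by its two orientations.  The library predicate \<open>tree\<close> cannot
  be used on such graphs, since for it the two orientations of an edge form a cycle of length 2;
  the cycles of the undirected graph are the directed cycles of length at least 3.
\<close>

definition simple_tree :: "'a pair_pre_digraph \<Rightarrow> bool" where
  "simple_tree G \<longleftrightarrow> pair_graph G \<and> connected (with_proj G) \<and>
     \<not> (\<exists>p. pre_digraph.cycle (with_proj G) p \<and> 3 \<le> length p)"

definition graph_order :: "'a pair_pre_digraph \<Rightarrow> nat" where
  "graph_order G = card (pverts G)"

abbreviation degree_of :: "'a pair_pre_digraph \<Rightarrow> 'a \<Rightarrow> nat" where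
  "degree_of G v \<equiv> out_degree (with_proj G) v"

definition graph_isomorphic :: "'a pair_pre_digraph \<Rightarrow> 'b pair_pre_digraph \<Rightarrow> bool" where
  "graph_isomorphic G H \<longleftrightarrow> digraph_iso (with_proj G) (with_proj H)"

definition dissociation_set :: "'a pair_pre_digraph \<Rightarrow> 'a set \<Rightarrow> bool" where
  "dissociation_set G S \<longleftrightarrow> S \<subseteq> pverts G \<and>
     (\<forall>v\<in>S. out_degree (induce_subgraph (with_proj G) S) v \<le> 1)"

definition dissociation_number :: "'a pair_pre_digraph \<Rightarrow> nat" where
  "dissociation_number G = Max (card ` {S. dissociation_set G S})"

text \<open>
  The matrices are written with respect to some enumeration of the vertices; another enumeration
  conjugates them by a permutation matrix and does not affect the eigenvalues.
\<close>

definition vertex_list :: "'a pair_pre_digraph \<Rightarrow> 'a list" where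
  "vertex_list G = (SOME vs. distinct vs \<and> set vs = pverts G)"

definition adjacency_matrix :: "'a pair_pre_digraph \<Rightarrow> real mat" where
  "adjacency_matrix G = mat (graph_order G) (graph_order G)
     (\<lambda>(i, j). if (vertex_list G ! i, vertex_list G ! j) \<in> parcs G then 1 else 0)"

definition degree_matrix :: "'a pair_pre_digraph \<Rightarrow> real mat" where
  "degree_matrix G = mat (graph_order G) (graph_order G)
     (\<lambda>(i, j). if i = j then real (degree_of G (vertex_list G ! i)) else 0)"

definition A_alpha :: "real \<Rightarrow> 'a pair_pre_digraph \<Rightarrow> real mat" where
  "A_alpha \<alpha> G = \<alpha> \<cdot>\<^sub>m degree_matrix G + (1 - \<alpha>) \<cdot>\<^sub>m adjacency_matrix G"

definition A_alpha_index :: "real \<Rightarrow> 'a pair_pre_digraph \<Rightarrow> real" where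
  "A_alpha_index \<alpha> G = Max {x. eigenvalue (A_alpha \<alpha> G) x}"

text \<open>
  \<open>Star_Vertex 0\<close> is the centre of the star on \<open>n - \<tau>\<close> vertices and \<open>Star_Vertex i\<close>,
  \<open>0 < i < n - \<tau>\<close>, are its leaves; \<open>Leaf_Pendant i j\<close> (\<open>j < 2\<close>) and \<open>Centre_Pendant j\<close> are the
  end vertices of the edges attached to the leaf \<open>i\<close> and to the centre.
  The number \<open>3 \<tau> - 2 n + 2\<close> is written \<open>3 \<tau> + 2 - 2 n\<close>; a tree of order \<open>n \<ge> 3\<close> has
  \<open>2 n / 3 \<le> \<tau> < n\<close>, so neither subtraction on \<open>nat\<close> truncates.
\<close>

datatype sdagger_vertex =
  Star_Vertex nat | Leaf_Pendant nat nat | Centre_Pendant nat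

definition sdagger_edges :: "nat \<Rightarrow> nat \<Rightarrow> sdagger_vertex rel" where
  "sdagger_edges n \<tau> =
     {(Star_Vertex 0, Star_Vertex i) | i. 0 < i \<and> i < n - \<tau>} \<union>
     {(Star_Vertex i, Leaf_Pendant i j) | i j. 0 < i \<and> i < n - \<tau> \<and> j < 2} \<union>
     {(Star_Vertex 0, Centre_Pendant j) | j. j < 3 * \<tau> + 2 - 2 * n}"

definition sdagger :: "nat \<Rightarrow> nat \<Rightarrow> sdagger_vertex pair_pre_digraph" where
  "sdagger n \<tau> = \<lparr>
     pverts = {Star_Vertex i | i. i < n - \<tau>} \<union>
              {Leaf_Pendant i j | i j. 0 < i \<and> i < n - \<tau> \<and> j < 2} \<union>
              {Centre_Pendant j | j. j < 3 * \<tau> + 2 - 2 * n},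
     parcs = sdagger_edges n \<tau> \<union> (sdagger_edges n \<tau>)\<inverse> \<rparr>"

definition P_alpha :: "real \<Rightarrow> real \<Rightarrow> real \<Rightarrow> real \<Rightarrow> real" where
  "P_alpha \<alpha> n \<tau> x =
     x ^ 4
     + \<alpha> * (n - 2 * \<tau> - 6) * x ^ 3
     + (8 * \<alpha>\<^sup>2 * \<tau> - 4 * \<alpha>\<^sup>2 * n + 4 * \<alpha> * \<tau> - 2 * \<alpha> * n - 2 * \<tau> + n
        + 9 * \<alpha>\<^sup>2 + 6 * \<alpha> - 3) * x\<^sup>2
     + \<alpha> * (16 * \<alpha> * n - \<alpha>\<^sup>2 * n - 8 * n - 28 * \<alpha> * \<tau> + 14 * \<tau> - 20 * \<alpha> + 10) * x
     + 2 * \<alpha> ^ 3 * n - 17 * \<alpha>\<^sup>2 * n + 16 * \<alpha> * n - 4 * n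
     + 24 * \<alpha>\<^sup>2 * \<tau> - 24 * \<alpha> * \<tau> + 6 * \<tau>
     - 2 * \<alpha> ^ 3 + 17 * \<alpha>\<^sup>2 - 16 * \<alpha> + 4"

text \<open>
  If \<open>\<tau> = n - 1\<close>, the star on \<open>n - \<tau>\<close> vertices has no leaves, \<open>sdagger n \<tau>\<close> is \<open>K\<^bsub>1,n-1\<^esub>\<close>, and
  \<open>P_alpha\<close> splits as
  \<open>((x - \<alpha> (n - 1)) (x - \<alpha>) - (n - 1) (1 - \<alpha>)\<^sup>2) ((x - 3 \<alpha>) (x - \<alpha>) - 2 (1 - \<alpha>)\<^sup>2)\<close>,
  where the largest zero of the first factor is the index of \<open>K\<^bsub>1,n-1\<^esub>\<close>.  For \<open>n \<ge> 4\<close> it is also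
  the largest zero of \<open>P_alpha\<close>; for \<open>n = 3\<close> and \<open>\<alpha> > 0\<close> the second factor has a larger zero, so
  that the index of the path on three vertices is smaller than \<open>theta\<close>.
\<close>

definition theta :: "real \<Rightarrow> nat \<Rightarrow> nat \<Rightarrow> real" where
  "theta \<alpha> n \<tau> = Max {x. P_alpha \<alpha> (real n) (real \<tau>) x = 0}"

end

theory Submission
  imports Defs "HOL-Computational_Algebra.Fundamental_Theorem_Algebra"
begin

text \<open>
  For an eigenvalue \<open>l\<close> root the tree at a vertex \<open>r\<close> where the eigenvector is largest in absolute value and
  normalise the absolute values \<open>x\<close> to \<open>x r = 1\<close>, so that \<open>l\<close> is at most the sum of
  \<open>\<alpha> + (1 - \<alpha>) x c\<close> over the children \<open>c\<close> of \<open>r\<close>.  Suppose \<open>l \<ge> theta\<close>.  By induction from the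
  leaves, a branch with \<open>s\<close> vertices that contains \<open>p\<close> disjoint connected pieces of size at least
  three contributes no more than \<open>p\<close> cherries and \<open>s - 3 p\<close> pendant vertices attached to \<open>r\<close>.
  The top vertices of a greedy cutting into such pieces meet every path on three vertices, so there
  are at least \<open>n - \<tau>\<close> pieces.  The resulting bound on \<open>l\<close> amounts to \<open>P_alpha\<close> being nonpositive at
  \<open>l\<close>, since \<open>P_alpha\<close> is the characteristic polynomial of the quotient matrix of \<open>sdagger n \<tau>\<close>.
  If \<open>\<tau> = n - 1\<close>, the comparison with pendant vertices alone, \<open>p = 0\<close>, suffices.
\<close>

section \<open>Rooted trees and subsolutions\<close>

text \<open>Passing to absolute values turns the eigenvalue equations into inequalities, so the
  comparison is made for subsolutions and applies to every eigenvector. Write \<open>\<beta>\<close>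
  for \<open>1 - \<alpha>\<close> and \<open>a\<close> for \<open>l - \<alpha>\<close>. Next to a
  root of value 1 a pendant vertex has value \<open>\<beta> / a\<close> and the centre of a cherry
  \<open>\<beta> / N\<close>, where \<open>N = a - 2 * A\<close>; this is the origin of
  \<open>A\<close> and \<open>H\<close>. The obstacle is that a cherry is an admissible competitor
  only if its centre does not exceed the root, that is if \<open>\<beta> \<le> N\<close>. This is
  where \<open>l \<ge> theta\<close> enters: beyond \<open>theta\<close> the quartic is nonnegative,
  and as the extremal tree has a cherry and at least two pendant vertices at its centre, this yields
  \<open>H \<le> N\<close>, which is the same condition. Pieces have size three because a cherry has
  three vertices; three pendant vertices contribute more than a cherry, so every further piece only
  lowers the bound. The equality cases are carried through the same inductions, since they determine
  the shape of the tree.\<close>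

locale rooted_tree =
  fixes V :: "'a set" and r :: 'a and par :: "'a \<Rightarrow> 'a" and rank :: "'a \<Rightarrow> nat"
  assumes finite_V: "finite V" and root_in_V: "r \<in> V"
    and par_in_V: "v \<in> V - {r} \<Longrightarrow> par v \<in> V"
    and rank_par_less: "v \<in> V - {r} \<Longrightarrow> rank (par v) < rank v"
begin

definition ch :: "'a \<Rightarrow> 'a set" where
  "ch v = {w \<in> V - {r}. par w = v}"

lemma finite_ch [simp]: "finite (ch v)"
  using finite_V by (simp add: ch_def)

lemma chD: "w \<in> ch v \<Longrightarrow> w \<in> V - {r} \<and> par w = v"
  by (simp add: ch_def)

lemma ch_in_V: "w \<in> ch v \<Longrightarrow> w \<in> V"
  by (simp add: ch_def)

text \<open>\<open>rank\<close> grows from parent to child and is bounded on the finite set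
  \<open>V\<close>, so its distance to the maximum falls on the way to the leaves. This is the
  measure behind \<open>tree_induct\<close> and the recursions \<open>tsum\<close> and
  \<open>res\<close>.\<close>

lemma height_ch_less:
  assumes "w \<in> ch v"
  shows "Max (rank ` V) - rank w < Max (rank ` V) - rank v"
proof -
  have "rank w \<le> Max (rank ` V)"
    using assms finite_V by (intro Max_ge) (auto simp: ch_def)
  then show ?thesis
    using assms rank_par_less[of w] by (auto simp: ch_def)
qed

lemma tree_induct [consumes 1, case_names step]:
  assumes "v \<in> V" and step: "\<And>v. v \<in> V \<Longrightarrow> (\<And>w. w \<in> ch v \<Longrightarrow> P w) \<Longrightarrow> P v"
  shows "P v"
  using assms(1)
proof (induction "Max (rank ` V) - rank v" arbitrary: v rule: less_induct)
  case less
  show ?case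
  proof (rule step)
    show "P w" if "w \<in> ch v" for w
      using less.hyps[of w, OF height_ch_less[OF that] ch_in_V[OF that]] .
  qed (rule less.prems)
qed

text \<open>The recursion stands for the sum of \<open>h\<close> over the subtree at
  \<open>v\<close>, so that sets of descendants never have to be named.\<close>

function tsum :: "('a \<Rightarrow> real) \<Rightarrow> 'a \<Rightarrow> real" where
  "tsum h v = h v + (\<Sum>w\<in>ch v. tsum h w)"
  by auto
termination
  by (relation "measure (\<lambda>(h, v). Max (rank ` V) - rank v)") (auto simp: height_ch_less)

declare tsum.simps [simp del]

lemma sum_ch: "(\<Sum>v\<in>V. \<Sum>w\<in>ch v. f w) = (\<Sum>w\<in>V - {r}. f w)"
proof -
  have "(\<Sum>v\<in>V. \<Sum>w\<in>ch v. f w) = sum f (\<Union>v\<in>V. ch v)"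
    using finite_V by (intro sum.UNION_disjoint[symmetric]) (auto simp: ch_def)
  also have "(\<Union>v\<in>V. ch v) = V - {r}"
    using par_in_V by (auto simp: ch_def)
  finally show ?thesis .
qed

lemma tsum_root: "tsum h r = (\<Sum>v\<in>V. h v)"
proof -
  have "(\<Sum>v\<in>V. tsum h v) = (\<Sum>v\<in>V. h v) + (\<Sum>v\<in>V. \<Sum>w\<in>ch v. tsum h w)"
    by (subst tsum.simps) (simp add: sum.distrib)
  also have "(\<Sum>v\<in>V. tsum h v) = tsum h r + (\<Sum>v\<in>V - {r}. tsum h v)"
    using finite_V root_in_V by (rule sum.remove)
  finally show ?thesis
    by (simp add: sum_ch)
qed

text \<open>
  The tree is cut from below into connected pieces with at least three vertices: \<open>res v\<close> is the
  number of vertices of the subtree at \<open>v\<close> that are not yet cut off when \<open>v\<close> is reached, and these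
  are cut off at \<open>v\<close> as soon as there are three of them.
\<close>

function res :: "'a \<Rightarrow> nat" where
  "res v = 1 + (\<Sum>w\<in>ch v. if 3 \<le> res w then 0 else res w)"
  by auto
termination
  by (relation "measure (\<lambda>v. Max (rank ` V) - rank v)") (auto simp: height_ch_less)

declare res.simps [simp del]

definition cut :: "'a \<Rightarrow> bool" where
  "cut v \<longleftrightarrow> 3 \<le> res v"

text \<open>The number of vertices that \<open>v\<close> hands up to its parent: none after a
  cut.\<close>

definition contrib :: "'a \<Rightarrow> nat" where
  "contrib v = (if cut v then 0 else res v)"

lemma res_eq: "res v = 1 + (\<Sum>w\<in>ch v. contrib w)"
  unfolding contrib_def cut_def by (rule res.simps)

lemma res_pos: "1 \<le> res v"
  by (simp add: res_eq)

lemma contrib_uncut: "\<not> cut v \<Longrightarrow> contrib v = res v"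
  by (simp add: contrib_def)

lemma res_leaf: "ch v = {} \<Longrightarrow> res v = 1"
  by (simp add: res_eq)

lemma uncut_leaf: "ch v = {} \<Longrightarrow> \<not> cut v"
  by (simp add: cut_def res_leaf)

lemma contrib_leaf: "ch v = {} \<Longrightarrow> contrib v = 1"
  by (simp add: contrib_uncut res_leaf uncut_leaf)

lemma res_chain: "ch v = {w} \<Longrightarrow> ch w = {} \<Longrightarrow> res v = 2"
  by (simp add: res_eq[of v] contrib_leaf)

lemma sum_contrib_cut: "cut v \<Longrightarrow> 2 \<le> (\<Sum>w\<in>ch v. contrib w)"
  using res_eq[of v] by (simp add: cut_def)

text \<open>Give a cut vertex the weight -2 and any other vertex the weight 1. The total over a
  subtree is at least \<open>contrib\<close>, because the two or more vertices handed up to a cut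
  vertex pay for its -2. The total at the root is the difference of the two sides.\<close>

lemma card_cut_le: "3 * card {v \<in> V. cut v} \<le> card V"
proof -
  define h where "h v = (if cut v then - 2 else 1 :: real)" for v
  have "v \<in> V \<Longrightarrow> real (contrib v) \<le> tsum h v" for v
  proof (induction rule: tree_induct)
    case (step v)
    have "real (\<Sum>w\<in>ch v. contrib w) \<le> (\<Sum>w\<in>ch v. tsum h w)"
      unfolding of_nat_sum using step.IH by (intro sum_mono) auto
    moreover have "real (res v) = 1 + real (\<Sum>w\<in>ch v. contrib w)"
      by (subst res_eq) simp
    moreover have "tsum h v = h v + (\<Sum>w\<in>ch v. tsum h w)"
      by (rule tsum.simps)
    moreover have "h v = (if cut v then - 2 else 1)" "cut v \<Longrightarrow> 3 \<le> res v"
      by (simp_all add: h_def cut_def)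
    ultimately show ?case
      by (simp add: contrib_def split: if_splits)
  qed
  from this[OF root_in_V] have "0 \<le> (\<Sum>v\<in>V. h v)"
    unfolding tsum_root by linarith
  also have "(\<Sum>v\<in>V. h v) = (\<Sum>v\<in>V. 1 - 3 * (if cut v then 1 else 0))"
    by (intro sum.cong) (auto simp: h_def)
  also have "\<dots> = real (card V) - 3 * real (card {v \<in> V. cut v})"
    using finite_V by (simp add: sum_subtractf flip: sum_distrib_left sum.inter_filter)
  finally show ?thesis
    by linarith
qed

text \<open>An uncut vertex has \<open>res\<close> at most 2, and each uncut child takes up at least
  one of it beyond the vertex itself. If the parent is uncut too, its \<open>res\<close> is larger
  still, which leaves \<open>res v = 1\<close> and no uncut child. Hence the uncut vertices will
  form a dissociation set.\<close>

lemma uncut_degree_le_one: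
  assumes "v \<in> V" "\<not> cut v"
  shows "card ({w \<in> ch v. \<not> cut w} \<union> (if v \<noteq> r \<and> \<not> cut (par v) then {par v} else {})) \<le> 1"
proof -
  have "card {w \<in> ch v. \<not> cut w} = (\<Sum>w\<in>{w \<in> ch v. \<not> cut w}. 1)"
    by simp
  also have "\<dots> \<le> (\<Sum>w\<in>{w \<in> ch v. \<not> cut w}. contrib w)"
    using res_pos by (intro sum_mono) (auto simp: contrib_def)
  also have "\<dots> \<le> (\<Sum>w\<in>ch v. contrib w)"
    by (intro sum_mono2) auto
  finally have card_le: "card {w \<in> ch v. \<not> cut w} + 1 \<le> res v"
    by (simp add: res_eq)
  show ?thesis
  proof (cases "v \<noteq> r \<and> \<not> cut (par v)")
    case True
    then have "v \<in> ch (par v)"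
      using assms by (simp add: ch_def)
    then have "contrib v \<le> (\<Sum>w\<in>ch (par v). contrib w)"
      by (intro member_le_sum) auto
    then have "res v + 1 \<le> res (par v)"
      using assms by (simp add: res_eq[of "par v"] contrib_uncut)
    with True have "card {w \<in> ch v. \<not> cut w} = 0"
      using card_le unfolding cut_def by linarith
    then have "{w \<in> ch v. \<not> cut w} = {}"
      using finite_subset[OF _ finite_ch, of "{w \<in> ch v. \<not> cut w}" v] by auto
    then have "{w \<in> ch v. \<not> cut w} \<union> (if v \<noteq> r \<and> \<not> cut (par v) then {par v} else {}) \<subseteq> {par v}"
      by (simp only: Un_empty_left) simp
    then show ?thesis
      using card_mono[of "{par v}"] by fastforce
  next
    case False
    then have "(if v \<noteq> r \<and> \<not> cut (par v) then {par v} else {}) = {}"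
      by (rule if_not_P)
    then show ?thesis
      using card_le assms(2) by (simp add: cut_def)
  qed
qed

end

section \<open>Subsolutions and the comparison with pendant vertices\<close>

locale subsolution = rooted_tree +
  fixes \<alpha> \<beta> a :: real and x :: "'a \<Rightarrow> real"
  assumes \<alpha>_nonneg: "0 \<le> \<alpha>" and \<beta>_pos: "0 < \<beta>" and \<alpha>_\<beta>: "\<alpha> + \<beta> = 1" and \<beta>_less: "\<beta> < a"
    and x_nonneg: "v \<in> V \<Longrightarrow> 0 \<le> x v" and x_le_1: "v \<in> V \<Longrightarrow> x v \<le> 1"
    and x_sub: "v \<in> V - {r} \<Longrightarrow> a * x v \<le> \<beta> * x (par v) + (\<Sum>w\<in>ch v. \<alpha> * x v + \<beta> * x w)"
begin

text \<open>A leaf \<open>c\<close> of the root with \<open>x r = 1\<close> and equality in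
  \<open>x_sub\<close> has \<open>x c = \<beta> / a\<close>, so \<open>A\<close> is its contribution
  \<open>\<alpha> + \<beta> * x c\<close>.\<close>

definition A :: real where
  "A = \<alpha> + \<beta>\<^sup>2 / a"

lemma a_pos: "0 < a"
  using \<beta>_pos \<beta>_less by linarith

lemma aA: "a * A = \<alpha> * a + \<beta>\<^sup>2"
  using a_pos by (simp add: A_def field_simps)

lemma A_pos: "0 < A"
  using \<alpha>_nonneg \<beta>_pos a_pos by (simp add: A_def add_nonneg_pos)

text \<open>An edge below \<open>v\<close> counts at most 1 in \<open>x_sub\<close>, hence at most
  \<open>\<beta>\<close> on the scale of \<open>\<beta> * x v\<close>. One pendant contribution,
  times \<open>a\<close>, covers this.\<close>

lemma \<beta>_le_aA: "\<beta> \<le> a * A"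
proof -
  have "\<beta> = \<alpha> * \<beta> + \<beta>\<^sup>2"
    using \<alpha>_\<beta> by (simp add: power2_eq_square flip: distrib_right)
  also have "\<dots> \<le> \<alpha> * a + \<beta>\<^sup>2"
    using \<alpha>_nonneg \<beta>_less by (simp add: mult_left_mono)
  finally show ?thesis
    by (simp add: aA)
qed

lemma edge_le_1: "v \<in> V \<Longrightarrow> w \<in> V \<Longrightarrow> \<alpha> * x v + \<beta> * x w \<le> 1"
  using convex_bound_le[of "x v" 1 "x w" \<alpha> \<beta>] \<alpha>_nonneg \<beta>_pos \<alpha>_\<beta> x_le_1 by simp

text \<open>In the equality cases this strict bound excludes a further level of the tree, whose
  vertices would have to be leaves of value 1.\<close>

lemma leaf_less_1:
  assumes "w \<in> V - {r}" "ch w = {}"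
  shows "x w < 1"
proof -
  have "a * x w \<le> \<beta> * x (par w)"
    using x_sub[OF assms(1)] assms(2) by simp
  also have "\<dots> \<le> \<beta>"
    using x_le_1[OF par_in_V[OF assms(1)]] \<beta>_pos by simp
  also note \<beta>_less
  finally show ?thesis
    using a_pos by simp
qed

lemma leaf_bound:
  assumes "w \<in> V - {r}" "ch w = {}"
  shows "x w \<le> \<beta> * x (par w) / a"
  using x_sub[OF assms(1)] assms(2) a_pos by (simp add: field_simps)

text \<open>After multiplication by \<open>a\<close>, the term \<open>A\<close> is
  \<open>\<alpha> * a + \<beta>\<^sup>2\<close> and pays for the edge to the parent, while the edge
  to a child \<open>w\<close> costs at most \<open>\<beta>\<close>, which \<open>B w\<close> covers
  by \<open>\<beta>_le_aA\<close>. In the case of equality each of these estimates is tight.\<close>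

lemma branch_bound:
  assumes v: "v \<in> V - {r}" and B: "\<And>w. w \<in> ch v \<Longrightarrow> A \<le> B w"
  shows "\<alpha> + \<beta> * x v \<le> A + (\<Sum>w\<in>ch v. B w)"
    and "\<alpha> + \<beta> * x v = A + (\<Sum>w\<in>ch v. B w) \<Longrightarrow>
      x (par v) = 1 \<and> (\<forall>w\<in>ch v. B w = A \<and> x w = 1)"
proof -
  have par: "\<beta>\<^sup>2 * x (par v) \<le> \<beta>\<^sup>2"
    using x_le_1[OF par_in_V[OF v]] by (simp add: mult_left_le)
  have v': "v \<in> V"
    using v by simp
  have child: "\<beta> * (\<alpha> * x v + \<beta> * x w) \<le> a * B w" if "w \<in> ch v" for w
  proof -
    have "\<beta> * (\<alpha> * x v + \<beta> * x w) \<le> \<beta>"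
      using edge_le_1[OF v' ch_in_V[OF that]] \<beta>_pos by (simp add: mult_left_le)
    also have "\<beta> \<le> a * A"
      by (rule \<beta>_le_aA)
    also have "\<dots> \<le> a * B w"
      using B[OF that] a_pos by simp
    finally show ?thesis .
  qed
  have "\<beta> * (a * x v) \<le> \<beta> * (\<beta> * x (par v) + (\<Sum>w\<in>ch v. \<alpha> * x v + \<beta> * x w))"
    using x_sub[OF v] \<beta>_pos by simp
  then have main: "a * (\<alpha> + \<beta> * x v)
      \<le> \<alpha> * a + \<beta>\<^sup>2 * x (par v) + (\<Sum>w\<in>ch v. \<beta> * (\<alpha> * x v + \<beta> * x w))"
    by (simp add: algebra_simps power2_eq_square sum_distrib_left)
  have sum_le: "(\<Sum>w\<in>ch v. \<beta> * (\<alpha> * x v + \<beta> * x w)) \<le> (\<Sum>w\<in>ch v. a * B w)"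
    using child by (rule sum_mono)
  have rhs: "a * (A + (\<Sum>w\<in>ch v. B w)) = \<alpha> * a + \<beta>\<^sup>2 + (\<Sum>w\<in>ch v. a * B w)"
    by (simp add: distrib_left aA sum_distrib_left)
  have "a * (\<alpha> + \<beta> * x v) \<le> a * (A + (\<Sum>w\<in>ch v. B w))"
    using main par sum_le unfolding rhs by linarith
  then show "\<alpha> + \<beta> * x v \<le> A + (\<Sum>w\<in>ch v. B w)"
    using a_pos by simp
  assume "\<alpha> + \<beta> * x v = A + (\<Sum>w\<in>ch v. B w)"
  then have "a * (\<alpha> + \<beta> * x v) = \<alpha> * a + \<beta>\<^sup>2 + (\<Sum>w\<in>ch v. a * B w)"
    using rhs by simp
  with main par sum_le have eqs: "\<beta>\<^sup>2 * x (par v) = \<beta>\<^sup>2"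
    "(\<Sum>w\<in>ch v. \<beta> * (\<alpha> * x v + \<beta> * x w)) = (\<Sum>w\<in>ch v. a * B w)"
    by linarith+
  have "B w = A \<and> x w = 1" if w: "w \<in> ch v" for w
  proof -
    have "\<beta> * (\<alpha> * x v + \<beta> * x w) = a * B w"
      using sum_mono_inv[OF eqs(2) child w finite_ch] .
    moreover have edge: "\<beta> * (\<alpha> * x v + \<beta> * x w) \<le> \<beta>"
      using edge_le_1[OF v' ch_in_V[OF w]] \<beta>_pos by (simp add: mult_left_le)
    moreover have "a * A \<le> a * B w"
      using B[OF w] a_pos by simp
    ultimately have eq: "\<beta> * (\<alpha> * x v + \<beta> * x w) = \<beta> * 1" "a * B w = a * A"
      using \<beta>_le_aA by linarith+
    then have "\<alpha> * x v + \<beta> * x w = 1" "B w = A"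
      using \<beta>_pos a_pos by simp_all
    moreover have "\<alpha> * x v \<le> \<alpha>"
      using x_le_1[OF v'] \<alpha>_nonneg by (simp add: mult_left_le)
    ultimately have "\<beta> * 1 \<le> \<beta> * x w"
      using \<alpha>_\<beta> by simp
    then show ?thesis
      using x_le_1[OF ch_in_V[OF w]] \<beta>_pos \<open>B w = A\<close> by simp
  qed
  then show "x (par v) = 1 \<and> (\<forall>w\<in>ch v. B w = A \<and> x w = 1)"
    using eqs(1) \<beta>_pos by auto
qed

lemma tsum_A_ge: "v \<in> V \<Longrightarrow> A \<le> tsum (\<lambda>_. A) v \<and> (tsum (\<lambda>_. A) v = A \<longrightarrow> ch v = {})"
proof (induction rule: tree_induct)
  case (step v)
  have *: "0 \<le> (\<Sum>w\<in>ch v. tsum (\<lambda>_. A) w)"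
    using step.IH A_pos by (intro sum_nonneg) fastforce
  have "ch v = {}" if "(\<Sum>w\<in>ch v. tsum (\<lambda>_. A) w) = 0"
  proof (rule ccontr)
    assume "ch v \<noteq> {}"
    then have "0 < (\<Sum>w\<in>ch v. tsum (\<lambda>_. A) w)"
      using step.IH A_pos by (intro sum_pos) fastforce+
    with that show False by simp
  qed
  with * show ?case
    by (simp add: tsum.simps[of _ v])
qed

text \<open>A branch is compared with its number of vertices times \<open>A\<close>. Equality at a
  vertex with a child \<open>w\<close> would make \<open>w\<close> a leaf with
  \<open>x w = 1\<close>, against \<open>leaf_less_1\<close>; so in the extremal case every branch
  is a single vertex.\<close>

theorem star_bound:
  assumes root: "\<alpha> + a \<le> (\<Sum>c\<in>ch r. \<alpha> + \<beta> * x c)"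
  shows "\<alpha> + a \<le> (real (card V) - 1) * A"
    and "\<alpha> + a = (real (card V) - 1) * A \<Longrightarrow> V = insert r (ch r) \<and> (\<forall>c\<in>ch r. ch c = {})"
proof -
  have bound: "\<alpha> + \<beta> * x v \<le> tsum (\<lambda>_. A) v" if "v \<in> V - {r}" for v
    unfolding tsum.simps[of _ v] using that tsum_A_ge ch_in_V by (intro branch_bound(1)) auto
  have bound_eq: "ch v = {}" if v: "v \<in> V - {r}" and eq: "\<alpha> + \<beta> * x v = tsum (\<lambda>_. A) v" for v
  proof (rule ccontr)
    assume "ch v \<noteq> {}"
    then obtain w where w: "w \<in> ch v" by blast
    have "tsum (\<lambda>_. A) w = A \<and> x w = 1"
      using branch_bound(2)[OF v, of "tsum (\<lambda>_. A)"] eq w tsum_A_ge ch_in_V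
      unfolding tsum.simps[of _ v] by auto
    then have "ch w = {}" "x w = 1"
      using tsum_A_ge ch_in_V[OF w] by auto
    then show False
      using leaf_less_1[of w] chD[OF w] by auto
  qed
  have tot: "(\<Sum>c\<in>ch r. tsum (\<lambda>_. A) c) = (real (card V) - 1) * A"
    using tsum_root[of "\<lambda>_. A"] unfolding tsum.simps[of _ r] by (simp add: algebra_simps)
  have le: "(\<Sum>c\<in>ch r. \<alpha> + \<beta> * x c) \<le> (\<Sum>c\<in>ch r. tsum (\<lambda>_. A) c)"
    using bound chD by (intro sum_mono) auto
  with root show "\<alpha> + a \<le> (real (card V) - 1) * A"
    using tot by linarith
  assume "\<alpha> + a = (real (card V) - 1) * A"
  with le root tot have eq: "(\<Sum>c\<in>ch r. \<alpha> + \<beta> * x c) = (\<Sum>c\<in>ch r. tsum (\<lambda>_. A) c)"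
    by linarith
  have leaf: "ch c = {}" if c: "c \<in> ch r" for c
  proof (rule bound_eq)
    show "\<alpha> + \<beta> * x c = tsum (\<lambda>_. A) c"
      using sum_mono_inv[OF eq _ c finite_ch] bound chD by blast
  qed (use chD[OF c] in auto)
  have "w \<in> insert r (ch r)" if "w \<in> V" for w
    using that
  proof (induction "rank w" arbitrary: w rule: less_induct)
    case less
    show ?case
    proof (cases "w = r")
      case False
      with less have "par w \<in> insert r (ch r)"
        using par_in_V rank_par_less by blast
      moreover have "w \<in> ch (par w)"
        using less.prems False by (simp add: ch_def)
      ultimately show ?thesis
        using leaf by auto
    qed simp
  qed
  then show "V = insert r (ch r) \<and> (\<forall>c\<in>ch r. ch c = {})"
    using root_in_V ch_in_V leaf by blast
qed

end


section \<open>Comparison with cherries\<close>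

locale heavy_subsolution = subsolution +
  assumes \<beta>_le_N: "\<beta> \<le> a - 2 * A"
begin

text \<open>The centre \<open>c\<close> of a cherry below a root of value 1 satisfies
  \<open>a * x c = \<beta> + 2 * A * x c\<close>, as each of its leaves has value
  \<open>\<beta> * x c / a\<close>. So \<open>x c = \<beta> / N\<close>, the cherry contributes
  \<open>\<alpha> + H\<close>, and \<open>\<beta> \<le> N\<close> says that \<open>x c\<close> does
  not exceed 1.\<close>

definition N :: real where
  "N = a - 2 * A"

definition H :: real where
  "H = \<beta>\<^sup>2 / N"

lemma N_ge: "\<beta> \<le> N" and N_pos: "0 < N" and N_less_a: "N < a"
  using \<beta>_le_N \<beta>_pos A_pos by (simp_all add: N_def)

lemma NH: "N * H = \<beta>\<^sup>2"
  using N_pos by (simp add: H_def)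

lemma H_pos: "0 < H"
  using N_pos \<beta>_pos by (simp add: H_def)

lemma A_less: "A < \<alpha> + H"
  using N_less_a N_pos \<beta>_pos by (simp add: A_def H_def frac_less2)

lemma \<beta>_le_N_\<alpha>H: "\<beta> + \<alpha> * (N - \<beta>) \<le> N * (\<alpha> + H)"
proof -
  have "\<beta> = \<alpha> * \<beta> + \<beta>\<^sup>2"
    using \<alpha>_\<beta> by (simp add: power2_eq_square flip: distrib_right)
  then show ?thesis
    using NH by (simp add: algebra_simps)
qed

lemma two_\<beta>_le_a: "2 * \<beta> \<le> a"
proof (rule ccontr)
  assume "\<not> 2 * \<beta> \<le> a"
  then have "\<beta> / 2 < \<beta>\<^sup>2 / a"
    using \<beta>_pos a_pos by (simp add: field_simps power2_eq_square)
  moreover have "2 * (\<beta>\<^sup>2 / a) \<le> a - \<beta>"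
    using \<beta>_le_N \<alpha>_nonneg by (simp add: A_def)
  ultimately show False
    using \<open>\<not> 2 * \<beta> \<le> a\<close> by linarith
qed

text \<open>This makes every cut a loss. If \<open>a < 3 * N\<close>, the terms with
  \<open>\<beta>\<^sup>2\<close> compare directly. Otherwise \<open>a \<le> 3 * A\<close>, and
  \<open>\<beta> \<le> N\<close> together with \<open>2 * \<beta> \<le> a\<close> bounds
  \<open>2 * \<beta>\<^sup>2\<close> by \<open>N * a\<close>.\<close>

lemma \<alpha>H_less: "\<alpha> + H < 3 * A"
proof -
  have "\<beta>\<^sup>2 < N * (3 * A - \<alpha>)"
  proof (cases "a < 3 * N")
    case True
    then have "\<beta>\<^sup>2 < 3 * N * (\<beta>\<^sup>2 / a)"
      using \<beta>_pos a_pos by (simp add: field_simps)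
    also have "\<dots> \<le> N * (3 * A - \<alpha>)"
      using N_pos \<alpha>_nonneg by (simp add: A_def algebra_simps)
    finally show ?thesis .
  next
    case False
    then have "a \<le> 3 * A"
      by (simp add: N_def)
    have "2 * \<beta>\<^sup>2 = \<beta> * (2 * \<beta>)"
      by (simp add: power2_eq_square)
    also have "\<dots> \<le> N * a"
      using N_ge two_\<beta>_le_a \<beta>_pos by (intro mult_mono) auto
    also have "\<dots> \<le> N * (3 * A)"
      using \<open>a \<le> 3 * A\<close> N_pos by simp
    also have "\<dots> < N * (2 * (3 * A - \<alpha>))"
    proof (rule mult_strict_left_mono[OF _ N_pos])
      have "0 < \<beta>\<^sup>2 / a"
        using \<beta>_pos a_pos by simp
      then show "3 * A < 2 * (3 * A - \<alpha>)"
        using \<alpha>_nonneg by (simp add: A_def)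
    qed
    finally show ?thesis
      by (simp add: algebra_simps)
  qed
  then have "N * H < N * (3 * A - \<alpha>)"
    by (simp add: NH)
  then show ?thesis
    using N_pos by simp
qed

text \<open>
  \<open>A\<close> and \<open>\<alpha> + H\<close> are the contributions of a pendant vertex and of a cherry attached to the root,
  so \<open>bud v = (s - 3 p) A + p (\<alpha> + H)\<close> for a branch with \<open>s\<close> vertices and \<open>p\<close> cuts.
\<close>

definition bud :: "'a \<Rightarrow> real" where
  "bud = tsum (\<lambda>v. A - (if cut v then 3 * A - \<alpha> - H else 0))"

lemma bud_eq: "bud v = A - (if cut v then 3 * A - \<alpha> - H else 0) + (\<Sum>w\<in>ch v. bud w)"
  unfolding bud_def by (rule tsum.simps)

text \<open>A cut exchanges \<open>3 * A\<close> for \<open>\<alpha> + H\<close>; the vertex itself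
  and the two or more vertices handed up to it supply the three. A cut child hands up nothing, and
  its whole budget is slack.\<close>

lemma bud_ge: "v \<in> V \<Longrightarrow> (if cut v then \<alpha> + H else A * contrib v) \<le> bud v"
proof (induction rule: tree_induct)
  case (step v)
  have "A * (\<Sum>w\<in>ch v. contrib w) \<le> (\<Sum>w\<in>ch v. bud w)"
    unfolding of_nat_sum sum_distrib_left
  proof (rule sum_mono)
    fix w assume "w \<in> ch v"
    from step.IH[OF this] show "A * real (contrib w) \<le> bud w"
      using H_pos \<alpha>_nonneg by (auto simp: contrib_def split: if_splits)
  qed
  moreover have "A * 2 \<le> A * (\<Sum>w\<in>ch v. contrib w)" if "cut v"
  proof -
    have "2 \<le> real (\<Sum>w\<in>ch v. contrib w)"
      using sum_contrib_cut[OF that] by linarith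
    then show ?thesis
      using A_pos by (intro mult_left_mono) auto
  qed
  moreover have "A * real (res v) = A + A * (\<Sum>w\<in>ch v. contrib w)"
    by (subst res_eq) (simp add: algebra_simps)
  ultimately show ?case
    by (subst bud_eq) (auto simp: contrib_def)
qed

lemma bud_ge_cut: "v \<in> V \<Longrightarrow> cut v \<Longrightarrow> \<alpha> + H \<le> bud v"
  using bud_ge[of v] by simp

lemma bud_ge_contrib: "v \<in> V \<Longrightarrow> A * contrib v \<le> bud v"
  using bud_ge[of v] H_pos \<alpha>_nonneg by (auto simp: contrib_def split: if_splits)

lemma bud_ge_A: "v \<in> V \<Longrightarrow> A \<le> bud v"
proof -
  assume "v \<in> V"
  moreover have "A * 1 \<le> A * res v"
    using A_pos res_pos[of v] by (intro mult_left_mono) auto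
  ultimately show ?thesis
    using bud_ge[of v] A_less by (auto simp: contrib_def split: if_splits)
qed

lemma bud_leaf: "ch v = {} \<Longrightarrow> bud v = A"
  by (subst bud_eq) (simp add: uncut_leaf)

lemma uncut_chain: "ch v = {w} \<Longrightarrow> ch w = {} \<Longrightarrow> \<not> cut v"
  by (simp add: cut_def res_chain)

lemma bud_chain: "ch v = {w} \<Longrightarrow> ch w = {} \<Longrightarrow> bud v = 2 * A"
  by (subst bud_eq) (simp add: uncut_chain bud_leaf)

text \<open>A cut child hands up nothing but has a budget of at least \<open>\<alpha> + H\<close>,
  and this surplus persists along uncut vertices. Without such a surplus in a child,
  \<open>res v \<le> 2\<close> leaves room for one further vertex only.\<close>

lemma bud_uncut_cases:
  "v \<in> V \<Longrightarrow> \<not> cut v \<Longrightarrow> ch v = {} \<or> (\<exists>w. ch v = {w} \<and> ch w = {}) \<or> A * res v + \<alpha> + H \<le> bud v"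
proof (induction rule: tree_induct)
  case (step v)
  show ?case
  proof (cases "\<exists>w\<in>ch v. A * contrib w + \<alpha> + H \<le> bud w")
    case True
    then obtain w where w: "w \<in> ch v" "A * contrib w + \<alpha> + H \<le> bud w"
      by blast
    have "(\<Sum>u\<in>ch v - {w}. A * contrib u) \<le> (\<Sum>u\<in>ch v - {w}. bud u)"
      using bud_ge_contrib ch_in_V by (intro sum_mono) auto
    then have "(\<Sum>u\<in>ch v. A * contrib u) + \<alpha> + H \<le> (\<Sum>u\<in>ch v. bud u)"
      using w(2) by (simp add: sum.remove[OF finite_ch w(1)])
    moreover have "A * real (res v) = A + (\<Sum>u\<in>ch v. A * contrib u)"
      by (subst res_eq) (simp add: distrib_left sum_distrib_left)
    moreover have "bud v = A + (\<Sum>u\<in>ch v. bud u)"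
      using step.prems by (subst bud_eq) simp
    ultimately show ?thesis
      by linarith
  next
    case False
    have uncut: "\<not> cut w" and shape: "ch w = {} \<or> (\<exists>u. ch w = {u} \<and> ch u = {})" if "w \<in> ch v" for w
    proof -
      show uncut: "\<not> cut w"
      proof
        assume "cut w"
        with False that bud_ge_cut[OF ch_in_V[OF that]] show False
          by (fastforce simp: contrib_def)
      qed
      show "ch w = {} \<or> (\<exists>u. ch w = {u} \<and> ch u = {})"
        using step.IH[OF that uncut] False that by (auto simp: contrib_uncut[OF uncut])
    qed
    have le: "(\<Sum>w\<in>ch v. contrib w) \<le> 1"
      using step.prems res_eq[of v] by (simp add: cut_def)
    have "card (ch v) = (\<Sum>w\<in>ch v. 1)"
      by simp
    also have "\<dots> \<le> (\<Sum>w\<in>ch v. contrib w)"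
      using uncut res_pos by (intro sum_mono) (simp add: contrib_uncut)
    finally have "card (ch v) \<le> 1"
      using le by linarith
    then consider "ch v = {}" | w where "ch v = {w}"
      by (metis card_1_singletonE card_eq_0_iff finite_ch le_antisym not_less_eq_eq One_nat_def le_zero_eq)
    then show ?thesis
    proof cases
      case (2 w)
      \<comment> \<open>A child with \<open>res w = 2\<close> would bring \<open>res v\<close> to 3,
        and \<open>v\<close> would be cut.\<close>
      have "\<not> (\<exists>u. ch w = {u} \<and> ch u = {})"
        using le 2 uncut[of w] by (auto simp: contrib_uncut res_chain)
      then show ?thesis
        using 2 shape[of w] by auto
    qed simp
  qed
qed

text \<open>The term of \<open>w\<close> in \<open>x_sub\<close> at its parent, times
  \<open>\<beta>\<close>, since the budgets are compared with \<open>\<beta> * x v\<close> and not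
  with \<open>x v\<close>.\<close>

definition cost :: "'a \<Rightarrow> real" where
  "cost w = \<beta> * (\<alpha> * x (par w) + \<beta> * x w)"

lemma cost_le: "w \<in> V - {r} \<Longrightarrow> cost w \<le> \<beta> * (\<alpha> + \<beta> * x w)"
  unfolding cost_def using x_le_1[OF par_in_V] \<alpha>_nonneg \<beta>_pos by (simp add: mult_left_le)

text \<open>The surplus of a child is measured at scale \<open>N\<close>, the one that belongs to
  the centre of a cherry; every vertex handed up must bring
  \<open>A * (N - \<beta> * x (par v))\<close>. A single leaf just achieves this. For a path of two
  vertices, \<open>N > 0\<close> means \<open>a - A > a / 2\<close>, so that \<open>x v\<close> is
  at most \<open>2 / a\<close> times \<open>\<beta> * x (par v)\<close>. In the remaining case a
  whole cherry is spare, and \<open>N * (\<alpha> + H) \<ge> \<beta>\<close> pays the cost.\<close>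

lemma cost_uncut:
  assumes v: "v \<in> V - {r}" and uncut: "\<not> cut v"
  shows "A * (N - \<beta> * x (par v)) * contrib v \<le> N * bud v - cost v"
    and "0 < x (par v) \<Longrightarrow> ch v \<noteq> {} \<Longrightarrow> A * (N - \<beta> * x (par v)) * contrib v < N * bud v - cost v"
proof -
  define y where "y = \<beta> * x (par v)"
  have pV: "par v \<in> V"
    using par_in_V[OF v] .
  have y0: "0 \<le> y"
    using x_nonneg[OF pV] \<beta>_pos by (simp add: y_def)
  have cost: "cost v = \<alpha> * y + \<beta>\<^sup>2 * x v"
    by (simp add: cost_def y_def algebra_simps power2_eq_square)
  have *: "A * (N - y) * contrib v \<le> N * bud v - cost v \<and>
    (0 < y \<longrightarrow> ch v \<noteq> {} \<longrightarrow> A * (N - y) * contrib v < N * bud v - cost v)"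
  proof -
    from v uncut consider "ch v = {}" | w where "ch v = {w}" "ch w = {}"
      | "A * res v + \<alpha> + H \<le> bud v"
      using bud_uncut_cases by blast
    then show ?thesis
    proof cases
      case 1
      have "\<beta>\<^sup>2 * x v \<le> \<beta>\<^sup>2 * (y / a)"
        unfolding y_def using leaf_bound[OF v 1] by (intro mult_left_mono) simp_all
      then show ?thesis
        using 1 by (simp add: contrib_leaf bud_leaf cost) (simp add: A_def algebra_simps diff_divide_distrib)
    next
      case (2 w)
      have w: "w \<in> V - {r}" "par w = v"
        using chD[of w v] 2 by auto
      have "a * x v \<le> y + \<alpha> * x v + \<beta> * x w"
        using x_sub[OF v] 2 by (simp add: y_def)
      also have "\<beta> * x w \<le> \<beta> * (\<beta> * x v / a)"
        using leaf_bound[OF w(1) 2(2)] w(2) \<beta>_pos by (intro mult_left_mono) simp_all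
      finally have le: "(a - A) * x v \<le> y"
        by (simp add: A_def algebra_simps power2_eq_square)
      have pos: "0 < a - A"
        using N_pos A_pos by (simp add: N_def)
      have "x v \<le> y / (a - A)"
        using le pos by (simp add: field_simps)
      also have "\<dots> \<le> y * (2 / a)" 
      proof -
        have "1 / (a - A) \<le> 2 / a"
          using N_pos pos a_pos by (simp add: N_def field_simps)
        from mult_left_mono[OF this y0] show ?thesis
          by simp
      qed
      finally have x_le: "x v \<le> y * (2 / a)" .
      have x_less: "x v < y * (2 / a)" if "0 < y"
      proof -
        have "x v \<le> y / (a - A)"
          using le pos by (simp add: field_simps)
        also have "\<dots> < y * (2 / a)"
          using that N_pos pos a_pos by (simp add: N_def field_simps)
        finally show ?thesis .
      qed
      have "\<alpha> * y + \<beta>\<^sup>2 * x v \<le> 2 * A * y" if "x v \<le> y * (2 / a)"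
      proof -
        have "\<beta>\<^sup>2 * x v \<le> \<beta>\<^sup>2 * (y * (2 / a))"
          using that by (intro mult_left_mono) simp_all
        moreover have "0 \<le> \<alpha> * y"
          using \<alpha>_nonneg y0 by simp
        ultimately show ?thesis
          by (simp add: A_def algebra_simps)
      qed
      moreover have "\<alpha> * y + \<beta>\<^sup>2 * x v < 2 * A * y" if "x v < y * (2 / a)"
      proof -
        have "\<beta>\<^sup>2 * x v < \<beta>\<^sup>2 * (y * (2 / a))"
          using that \<beta>_pos by (intro mult_strict_left_mono) simp_all
        moreover have "0 \<le> \<alpha> * y"
          using \<alpha>_nonneg y0 by simp
        ultimately show ?thesis
          by (simp add: A_def algebra_simps)
      qed
      moreover have "A * (N - y) * contrib v = N * bud v - 2 * A * y"
        using bud_chain[OF 2] res_chain[OF 2] by (simp add: contrib_uncut[OF uncut] algebra_simps)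
      ultimately show ?thesis
        using x_le x_less cost by auto
    next
      case 3
      have "N * (A * res v) + N * (\<alpha> + H) \<le> N * bud v"
        using 3 N_pos by (simp flip: distrib_left)
      moreover have "cost v \<le> \<beta>"
        unfolding cost_def using edge_le_1[OF pV, of v] v \<beta>_pos by (simp add: mult_left_le)
      moreover have "\<beta> \<le> N * (\<alpha> + H)"
        using \<beta>_le_N_\<alpha>H N_ge \<alpha>_nonneg mult_nonneg_nonneg[of \<alpha> "N - \<beta>"] by linarith
      ultimately have "N * (A * res v) \<le> N * bud v - cost v"
        by linarith
      moreover have "A * (N - y) * res v = N * (A * res v) - y * (A * res v)"
        by (simp add: algebra_simps)
      moreover have "0 \<le> y * (A * res v)" "0 < y \<Longrightarrow> 0 < y * (A * res v)"
        using y0 A_pos res_pos[of v] by simp_all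
      ultimately show ?thesis
        unfolding contrib_uncut[OF uncut] by linarith
    qed
  qed
  then show "A * (N - \<beta> * x (par v)) * contrib v \<le> N * bud v - cost v"
    by (simp add: y_def)
  assume "0 < x (par v)" "ch v \<noteq> {}"
  with * show "A * (N - \<beta> * x (par v)) * contrib v < N * bud v - cost v"
    using \<beta>_pos by (simp add: y_def)
qed

text \<open>A cut child hands up nothing, so its budget only has to pay its own cost. The induction
  hypothesis does so at scale \<open>\<beta>\<close>, and \<open>\<beta> \<le> N\<close> allows the
  change of scale.\<close>

lemma cost_cut:
  assumes v: "v \<in> V - {r}" and cut: "cut v" and IH: "\<alpha> + \<beta> * x v \<le> bud v"
  shows "cost v \<le> N * bud v"
    and "cost v = N * bud v \<Longrightarrow> N = \<beta> \<and> \<alpha> + \<beta> * x v = bud v"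
proof -
  have pos: "0 < bud v"
    using bud_ge_A[of v] A_pos v by simp
  have "\<beta> * (\<alpha> + \<beta> * x v) \<le> \<beta> * bud v" "\<beta> * bud v \<le> N * bud v"
    using IH \<beta>_pos N_ge pos by simp_all
  note * = cost_le[OF v] this
  then show "cost v \<le> N * bud v"
    by linarith
  assume "cost v = N * bud v"
  with * have "\<beta> * (\<alpha> + \<beta> * x v) = \<beta> * bud v" "\<beta> * bud v = N * bud v"
    by linarith+
  then show "N = \<beta> \<and> \<alpha> + \<beta> * x v = bud v"
    using pos \<beta>_pos by simp
qed

text \<open>At scale \<open>N\<close> the claim splits into three nonnegative parts: the slack of
  \<open>x (par v) \<le> 1\<close>, the slack of \<open>x_sub\<close>, and the surplus of the
  children over \<open>A * (N - y) * 2\<close>. The last one is nonnegative because at least two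
  vertices are handed up to a cut vertex.\<close>

lemma branch_bound_cut:
  assumes v: "v \<in> V - {r}" and cut: "cut v"
    and IH: "\<And>w. w \<in> ch v \<Longrightarrow> \<alpha> + \<beta> * x w \<le> bud w"
    and IH_eq: "\<And>w. w \<in> ch v \<Longrightarrow> \<alpha> + \<beta> * x w = bud w \<Longrightarrow>
      x v = 1 \<and> (cut w \<or> ch w = {})"
  shows "\<alpha> + \<beta> * x v \<le> bud v"
    and "\<alpha> + \<beta> * x v = bud v \<Longrightarrow> x (par v) = 1 \<and> card (ch v) = 2 \<and> (\<forall>w\<in>ch v. ch w = {})"
proof -
  have vV: "v \<in> V"
    using v by simp
  define y where "y = \<beta> * x v"
  have y0: "0 \<le> y" and y_le: "y \<le> \<beta>"
    using x_nonneg[OF vV] x_le_1[OF vV] \<beta>_pos by (simp_all add: y_def mult_left_le)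
  define e where "e w = N * bud w - cost w" for w
  have chV: "w \<in> V - {r}" and par: "par w = v" if "w \<in> ch v" for w
    using chD[OF that] by auto
  have Ny: "0 \<le> A * (N - y)"
    using A_pos N_ge y_le by simp
  have e_ge: "A * (N - y) * contrib w \<le> e w" if w: "w \<in> ch v" for w
  proof (cases "cut w")
    case True
    then show ?thesis
      using cost_cut(1)[OF chV[OF w] True IH[OF w]] by (simp add: e_def contrib_def)
  next
    case False
    then show ?thesis
      using cost_uncut(1)[OF chV[OF w] False] by (simp add: e_def y_def par[OF w])
  qed
  have sum_contrib: "2 \<le> real (\<Sum>w\<in>ch v. contrib w)"
    using sum_contrib_cut[OF cut] by linarith
  have "A * (N - y) * 2 \<le> A * (N - y) * real (\<Sum>w\<in>ch v. contrib w)"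
    using Ny sum_contrib by (rule mult_left_mono[rotated])
  also have eq_sum: "\<dots> = (\<Sum>w\<in>ch v. A * (N - y) * contrib w)"
    by (simp add: sum_distrib_left)
  also have sum_e_ge: "\<dots> \<le> (\<Sum>w\<in>ch v. e w)"
    using e_ge by (rule sum_mono)
  finally have sum_e: "A * (N - y) * 2 \<le> (\<Sum>w\<in>ch v. e w)" .
  have "\<beta> * (a * x v) \<le> \<beta> * (\<beta> * x (par v) + (\<Sum>w\<in>ch v. \<alpha> * x v + \<beta> * x w))"
    using x_sub[OF v] \<beta>_pos by simp
  also have "\<dots> = \<beta>\<^sup>2 * x (par v) + (\<Sum>w\<in>ch v. cost w)"
    using par by (simp add: cost_def distrib_left power2_eq_square sum_distrib_left)
  finally have ay: "a * y \<le> \<beta>\<^sup>2 * x (par v) + (\<Sum>w\<in>ch v. cost w)"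
    by (simp add: y_def algebra_simps)
  have bud_v: "bud v = \<alpha> + H - 2 * A + (\<Sum>w\<in>ch v. bud w)"
    using cut by (subst bud_eq) simp
  have "(\<Sum>w\<in>ch v. e w) = N * (\<Sum>w\<in>ch v. bud w) - (\<Sum>w\<in>ch v. cost w)"
    by (simp add: e_def sum_subtractf sum_distrib_left)
  \<comment> \<open>The \<open>2 * A\<close> lost at the cut is, at scale \<open>N\<close>, the sum
    of \<open>A * (N - y) * 2\<close> and \<open>2 * A * y\<close>; the second summand turns
    \<open>N * y\<close> into \<open>a * y\<close>.\<close>
  then have gap: "N * (bud v - \<alpha> - y) = (\<beta>\<^sup>2 - \<beta>\<^sup>2 * x (par v))
      + (\<beta>\<^sup>2 * x (par v) + (\<Sum>w\<in>ch v. cost w) - a * y) + ((\<Sum>w\<in>ch v. e w) - A * (N - y) * 2)"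
    using NH by (simp add: bud_v N_def algebra_simps)
  have par_le: "\<beta>\<^sup>2 * x (par v) \<le> \<beta>\<^sup>2"
    using x_le_1[OF par_in_V[OF v]] by (simp add: mult_left_le)
  have "0 \<le> N * (bud v - \<alpha> - y)"
    unfolding gap using par_le ay sum_e by simp
  then show "\<alpha> + \<beta> * x v \<le> bud v"
    using N_pos by (simp add: zero_le_mult_iff y_def)
  assume eq: "\<alpha> + \<beta> * x v = bud v"
  then have "N * (bud v - \<alpha> - y) = 0"
    by (simp add: y_def)
  with gap par_le ay sum_e have eqs: "\<beta>\<^sup>2 * x (par v) = \<beta>\<^sup>2"
    "(\<Sum>w\<in>ch v. e w) = A * (N - y) * 2"
    by linarith+
  then have par1: "x (par v) = 1"
    using \<beta>_pos by simp
  have y_pos: "0 < y"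
    using eq bud_ge_cut[OF vV cut] H_pos by (simp add: y_def)
  then have xv: "0 < x v"
    using \<beta>_pos by (simp add: y_def zero_less_mult_iff)
  have sums_eq: "(\<Sum>w\<in>ch v. A * (N - y) * contrib w) = (\<Sum>w\<in>ch v. e w)"
    and Ncontrib: "A * (N - y) * real (\<Sum>w\<in>ch v. contrib w) = A * (N - y) * 2"
    using \<open>A * (N - y) * 2 \<le> A * (N - y) * real (\<Sum>w\<in>ch v. contrib w)\<close> eq_sum sum_e_ge eqs(2)
    by linarith+
  have e_eq: "A * (N - y) * contrib w = e w" if w: "w \<in> ch v" for w
    using sum_mono_inv[OF sums_eq e_ge w finite_ch] .
  have leaf_or_cut: "cut w \<or> ch w = {}" if w: "w \<in> ch v" for w
  proof (rule ccontr)
    assume *: "\<not> (cut w \<or> ch w = {})"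
    then show False
      using cost_uncut(2)[OF chV[OF w]] e_eq[OF w] xv by (simp add: e_def y_def par[OF w])
  qed
  have "card (ch v) = 2 \<and> (\<forall>w\<in>ch v. ch w = {})"
  \<comment> \<open>If \<open>N = y\<close>, the weight \<open>A * (N - y)\<close> vanishes and its
    tightness says nothing about the children; the budgets of the children, which then add up to
    \<open>2 * A\<close>, are counted instead.\<close>
  proof (cases "N = y")
    case True
    then have N: "N = \<beta>" "y = \<beta>"
      using N_ge y_le by simp_all
    then have "H = \<beta>"
      using \<beta>_pos by (simp add: H_def power2_eq_square)
    then have sum_bud: "(\<Sum>w\<in>ch v. bud w) = 2 * A"
      using eq bud_v N by (simp add: y_def)
    have "\<not> cut w" if w: "w \<in> ch v" for w
    proof
      assume "cut w"
      have "A * contrib u \<le> bud u" if "u \<in> ch v" for u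
        using bud_ge_contrib[OF ch_in_V[OF that]] .
      then have "(\<Sum>u\<in>ch v. A * contrib u) = (\<Sum>u\<in>ch v. bud u)"
      proof -
        assume *: "\<And>u. u \<in> ch v \<Longrightarrow> A * contrib u \<le> bud u"
        have "A * 2 \<le> (\<Sum>u\<in>ch v. A * contrib u)"
          using mult_left_mono[OF sum_contrib, of A] A_pos by (simp add: sum_distrib_left)
        moreover have "(\<Sum>u\<in>ch v. A * contrib u) \<le> (\<Sum>u\<in>ch v. bud u)"
          using * by (rule sum_mono)
        ultimately show ?thesis
          using sum_bud by linarith
      qed
      from sum_mono_inv[OF this bud_ge_contrib[OF ch_in_V] w finite_ch]
      have "bud w = 0"
        using \<open>cut w\<close> by (simp add: contrib_def)
      then show False
        using bud_ge_A[OF ch_in_V[OF w]] A_pos by simp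
    qed
    then have leaves: "\<forall>w\<in>ch v. ch w = {}"
      using leaf_or_cut by blast
    then have "(\<Sum>w\<in>ch v. bud w) = real (card (ch v)) * A"
      by (simp add: bud_leaf)
    then show ?thesis
      using sum_bud A_pos leaves by simp
  next
    case False
    then have less: "y < N"
      using y_le N_ge by linarith
    have "\<not> cut w" if w: "w \<in> ch v" for w
    proof
      assume "cut w"
      then have "cost w = N * bud w"
        using e_eq[OF w] by (simp add: e_def contrib_def)
      \<comment> \<open>Together these give \<open>y = N\<close>, the case excluded here.\<close>
      then have "N = \<beta>" "x v = 1"
        using cost_cut(2)[OF chV[OF w] \<open>cut w\<close> IH[OF w]] IH_eq[OF w] by auto
      with less show False
        by (simp add: y_def)
    qed
    then have leaves: "\<forall>w\<in>ch v. ch w = {}"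
      using leaf_or_cut by blast
    moreover have "(\<Sum>w\<in>ch v. contrib w) = 2"
    proof -
      have "real (\<Sum>w\<in>ch v. contrib w) = 2"
        using Ncontrib A_pos less by simp
      then show ?thesis
        by linarith
    qed
    ultimately show ?thesis
      by (simp add: contrib_leaf)
  qed
  with par1 show "x (par v) = 1 \<and> card (ch v) = 2 \<and> (\<forall>w\<in>ch v. ch w = {})"
    by blast
qed

text \<open>Without a cut at \<open>v\<close> the coarse estimate \<open>branch_bound\<close>
  suffices. Under equality a child would have budget \<open>A\<close> and value 1; the budget makes
  it a leaf, and a leaf has a value below 1.\<close>

lemma branch_bound_uncut:
  assumes v: "v \<in> V - {r}" and uncut: "\<not> cut v"
  shows "\<alpha> + \<beta> * x v \<le> bud v"
    and "\<alpha> + \<beta> * x v = bud v \<Longrightarrow> x (par v) = 1 \<and> ch v = {}"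
proof -
  have bud_v: "bud v = A + (\<Sum>w\<in>ch v. bud w)"
    using uncut by (subst bud_eq) simp
  show "\<alpha> + \<beta> * x v \<le> bud v"
    unfolding bud_v using v bud_ge_A ch_in_V by (intro branch_bound(1)) auto
  assume eq: "\<alpha> + \<beta> * x v = bud v"
  have *: "x (par v) = 1 \<and> (\<forall>w\<in>ch v. bud w = A \<and> x w = 1)"
    using branch_bound(2)[OF v, of bud] eq bud_v bud_ge_A ch_in_V by simp
  have "ch v = {}"
  proof (rule ccontr)
    assume "ch v \<noteq> {}"
    then obtain w where w: "w \<in> ch v" by blast
    with * have bw: "bud w = A" "x w = 1" by auto
    have "\<not> cut w"
      using bud_ge_cut[OF ch_in_V[OF w]] bw A_less by auto
    moreover have "A < A * res w + \<alpha> + H"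
      using A_less A_pos res_pos[of w] mult_left_mono[of 1 "real (res w)" A] by linarith
    ultimately have "ch w = {}"
      using bud_uncut_cases[OF ch_in_V[OF w]] bw(1) A_pos bud_chain[of w] by auto
    then show False
      using leaf_less_1[of w] chD[OF w] bw by auto
  qed
  with * show "x (par v) = 1 \<and> ch v = {}"
    by blast
qed

text \<open>The equality case has to be part of the induction: at a cut vertex \<open>v\<close>,
  equality in a cut child is excluded only by knowing that it would force
  \<open>x v = 1\<close>.\<close>

lemma bud_bound_step:
  "v \<in> V \<Longrightarrow> v \<noteq> r \<Longrightarrow> \<alpha> + \<beta> * x v \<le> bud v \<and>
    (\<alpha> + \<beta> * x v = bud v \<longrightarrow> x (par v) = 1 \<and>
      (if cut v then card (ch v) = 2 \<and> (\<forall>w\<in>ch v. ch w = {}) else ch v = {}))"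
proof (induction rule: tree_induct)
  case (step v)
  have v: "v \<in> V - {r}"
    using step.hyps step.prems by blast
  show ?case
  proof (cases "cut v")
    case True
    have IH: "\<alpha> + \<beta> * x w \<le> bud w"
      "\<alpha> + \<beta> * x w = bud w \<Longrightarrow> x v = 1 \<and> (cut w \<or> ch w = {})" if "w \<in> ch v" for w
      using step.IH[OF that] chD[OF that] by (metis Diff_iff insertI1)+
    show ?thesis
      using branch_bound_cut[OF v True IH] unfolding if_P[OF True] by blast
  next
    case False
    show ?thesis
      using branch_bound_uncut[OF v False] unfolding if_not_P[OF False] by blast
  qed
qed

lemma bud_bound: "v \<in> V - {r} \<Longrightarrow> \<alpha> + \<beta> * x v \<le> bud v"
  using bud_bound_step by blast

lemma bud_bound_eq:
  "v \<in> V - {r} \<Longrightarrow> \<alpha> + \<beta> * x v = bud v \<Longrightarrow>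
    if cut v then card (ch v) = 2 \<and> (\<forall>w\<in>ch v. ch w = {}) else ch v = {}"
  using bud_bound_step by blast

theorem cherry_bound:
  assumes root: "\<alpha> + a \<le> (\<Sum>c\<in>ch r. \<alpha> + \<beta> * x c)"
    and k: "k + 1 \<le> card {v \<in> V. cut v}"
  shows "\<alpha> + a \<le> (real (card V) - 1) * A - real k * (3 * A - \<alpha> - H)"
    and "\<alpha> + a = (real (card V) - 1) * A - real k * (3 * A - \<alpha> - H) \<Longrightarrow>
      (\<forall>c\<in>ch r. if cut c then card (ch c) = 2 \<and> (\<forall>w\<in>ch c. ch w = {}) else ch c = {}) \<and>
      card {v \<in> V - {r}. cut v} = k"
proof -
  define D where "D = 3 * A - \<alpha> - H"
  have D: "0 < D"
    using \<alpha>H_less by (simp add: D_def)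
  have bud_r: "(\<Sum>c\<in>ch r. bud c) = (real (card V) - 1) * A - real (card {v \<in> V - {r}. cut v}) * D"
  proof -
    have "bud r = (\<Sum>v\<in>V. A - (if cut v then D else 0))"
      unfolding bud_def D_def tsum_root by simp
    also have "\<dots> = A - (if cut r then D else 0) + (\<Sum>v\<in>V - {r}. A - (if cut v then D else 0))"
      using finite_V root_in_V by (rule sum.remove)
    also have "(\<Sum>v\<in>V - {r}. A - (if cut v then D else 0)) =
        real (card (V - {r})) * A - (\<Sum>v\<in>V - {r}. if cut v then D else 0)"
      by (simp add: sum_subtractf)
    also have "(\<Sum>v\<in>V - {r}. if cut v then D else 0) = real (card {v \<in> V - {r}. cut v}) * D"
      using finite_V by (subst sum.inter_filter[symmetric]) simp_all
    also have "real (card (V - {r})) = real (card V) - 1"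
      using finite_V root_in_V card_gt_0_iff[of V] by (subst card_Diff_singleton) auto
    finally show ?thesis
      using bud_eq[of r] unfolding D_def by linarith
  qed
  \<comment> \<open>The root may itself be cut and belongs to no branch; this is the reason for
    \<open>k + 1\<close> in the assumption.\<close>
  have "card {v \<in> V. cut v} \<le> card (insert r {v \<in> V - {r}. cut v})"
    using finite_V by (intro card_mono) auto
  also have "\<dots> \<le> Suc (card {v \<in> V - {r}. cut v})"
    by (rule card_insert_le_m1) simp_all
  finally have k': "k \<le> card {v \<in> V - {r}. cut v}"
    using k by simp
  then have kD: "real k * D \<le> real (card {v \<in> V - {r}. cut v}) * D"
    using D by simp
  have chr: "c \<in> V - {r}" if "c \<in> ch r" for c
    using chD[OF that] by auto
  have le: "(\<Sum>c\<in>ch r. \<alpha> + \<beta> * x c) \<le> (\<Sum>c\<in>ch r. bud c)"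
    using bud_bound[OF chr] by (rule sum_mono)
  show "\<alpha> + a \<le> (real (card V) - 1) * A - real k * (3 * A - \<alpha> - H)"
    using root le bud_r kD unfolding D_def by linarith
  assume "\<alpha> + a = (real (card V) - 1) * A - real k * (3 * A - \<alpha> - H)"
  then have eqs: "(\<Sum>c\<in>ch r. \<alpha> + \<beta> * x c) = (\<Sum>c\<in>ch r. bud c)"
    "real k * D = real (card {v \<in> V - {r}. cut v}) * D"
    using root le bud_r kD unfolding D_def by linarith+
  have "\<alpha> + \<beta> * x c = bud c" if c: "c \<in> ch r" for c
    using sum_mono_inv[OF eqs(1) bud_bound[OF chr] c finite_ch] .
  then have "\<forall>c\<in>ch r. if cut c then card (ch c) = 2 \<and> (\<forall>w\<in>ch c. ch w = {}) else ch c = {}"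
    using bud_bound_eq chr by blast
  moreover have "card {v \<in> V - {r}. cut v} = k"
    using eqs(2) D by simp
  ultimately show "(\<forall>c\<in>ch r. if cut c then card (ch c) = 2 \<and> (\<forall>w\<in>ch c. ch w = {}) else ch c = {}) \<and>
      card {v \<in> V - {r}. cut v} = k"
    by blast
qed

end

section \<open>The largest zero of the quartic\<close>

lemma P_alpha_monic_poly: "\<exists>p. lead_coeff p = 1 \<and> (\<forall>x. P_alpha \<alpha> n \<tau> x = poly p x)"
  by (rule exI[of _ "[:P_alpha \<alpha> n \<tau> 0,
    \<alpha> * (16 * \<alpha> * n - \<alpha>\<^sup>2 * n - 8 * n - 28 * \<alpha> * \<tau> + 14 * \<tau> - 20 * \<alpha> + 10),
    8 * \<alpha>\<^sup>2 * \<tau> - 4 * \<alpha>\<^sup>2 * n + 4 * \<alpha> * \<tau> - 2 * \<alpha> * n - 2 * \<tau> + n + 9 * \<alpha>\<^sup>2 + 6 * \<alpha> - 3,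
    \<alpha> * (n - 2 * \<tau> - 6), 1:]"])
    (simp add: P_alpha_def power2_eq_square power3_eq_cube power4_eq_xxxx algebra_simps)

text \<open>A monic quartic has a zero above every point at which it is nonpositive. Such a point
  also shows that the set under \<open>Max\<close> is nonempty.\<close>

lemma theta_ge:
  assumes "P_alpha \<alpha> (real n) (real \<tau>) y \<le> 0"
  shows "y \<le> theta \<alpha> n \<tau>" and "P_alpha \<alpha> (real n) (real \<tau>) (theta \<alpha> n \<tau>) = 0"
proof -
  let ?P = "P_alpha \<alpha> (real n) (real \<tau>)"
  obtain p where p: "\<And>x. ?P x = poly p x" "lead_coeff p = 1"
    using P_alpha_monic_poly by metis
  then have p0: "p \<noteq> 0"
    by auto
  have fin: "finite {x. ?P x = 0}"
    using poly_roots_finite[OF p0] by (simp add: p(1))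
  obtain b where b: "\<And>x. b \<le> x \<Longrightarrow> 1 \<le> poly p x"
    using poly_pinfty_gt_lc[of p] p(2) by auto
  have "\<exists>x. y \<le> x \<and> x \<le> max b y \<and> poly p x = 0"
    using assms b[of "max b y"] by (intro IVT) (auto simp: p(1))
  then obtain x where x: "y \<le> x" "?P x = 0"
    by (auto simp: p(1))
  then show "?P (theta \<alpha> n \<tau>) = 0"
    using Max_in[OF fin] unfolding theta_def by auto
  have "x \<le> theta \<alpha> n \<tau>"
    unfolding theta_def using fin x(2) by (intro Max_ge) auto
  with x(1) show "y \<le> theta \<alpha> n \<tau>"
    by simp
qed

text \<open>Here \<open>k\<close> is the number of cherries of \<open>sdagger n \<tau>\<close>,
  \<open>n - 1 - 3 * k\<close> the number of pendant vertices at its centre and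
  \<open>n - 1 - 2 * k\<close> the degree of the centre. The right-hand side expands the
  characteristic determinant of the quotient matrix: a block for the centre with its pendant
  vertices, the block \<open>Q\<close> of a cherry, and their coupling.\<close>

lemma P_alpha_factor:
  assumes "\<beta> = 1 - \<alpha>" and "a = x - \<alpha>" and "k = n - \<tau> - 1" and "Q = (x - 3 * \<alpha>) * a - 2 * \<beta>\<^sup>2"
  shows "P_alpha \<alpha> n \<tau> x =
    ((x - \<alpha> * (n - 1 - 2 * k)) * a - (n - 1 - 3 * k) * \<beta>\<^sup>2) * Q - k * \<beta>\<^sup>2 * a\<^sup>2"
  unfolding assms P_alpha_def by (simp add: power2_eq_square power3_eq_cube power4_eq_xxxx algebra_simps)

lemma P_alpha_eq_star:
  assumes "a = x - \<alpha>"
  shows "P_alpha \<alpha> n (n - 1) x = ((x - \<alpha> * (n - 1)) * a - (n - 1) * (1 - \<alpha>)\<^sup>2) *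
    ((x - 3 * \<alpha>) * a - 2 * (1 - \<alpha>)\<^sup>2)"
  using P_alpha_factor[OF refl assms, of 0 n "n - 1"] by simp

text \<open>The cherry block equals \<open>a * N\<close>. For \<open>N > 0\<close> the sign of the
  quartic thus tells on which side of the bound in \<open>cherry_bound\<close> the point
  \<open>x\<close> lies.\<close>

lemma P_alpha_eq:
  fixes \<alpha> x n \<tau> :: real
  assumes a: "a = x - \<alpha>" "a \<noteq> 0" and k: "k = n - \<tau> - 1"
    and A: "A = \<alpha> + (1 - \<alpha>)\<^sup>2 / a" and N: "N = a - 2 * A" "N \<noteq> 0" and H: "H = (1 - \<alpha>)\<^sup>2 / N"
  shows "P_alpha \<alpha> n \<tau> x = a\<^sup>2 * N * (x - ((n - 1) * A - k * (3 * A - \<alpha> - H)))"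
proof -
  have aA: "a * A = \<alpha> * a + (1 - \<alpha>)\<^sup>2"
    using a by (simp add: A field_simps)
  have NH: "N * H = (1 - \<alpha>)\<^sup>2"
    using N(2) by (simp add: H)
  have "a * N = a * a - 2 * (a * A)"
    by (simp add: N algebra_simps)
  then have Q: "(x - 3 * \<alpha>) * a - 2 * (1 - \<alpha>)\<^sup>2 = a * N"
    unfolding aA by (simp add: a(1) algebra_simps)
  have "a\<^sup>2 * N * (x - ((n - 1) * A - k * (3 * A - \<alpha> - H))) =
      a * N * (a * x - (n - 1) * (a * A) + k * (3 * (a * A) - a * \<alpha>)) - k * a\<^sup>2 * (N * H)"
    by (simp add: power2_eq_square algebra_simps)
  also have "\<dots> = ((x - \<alpha> * (n - 1 - 2 * k)) * a - (n - 1 - 3 * k) * (1 - \<alpha>)\<^sup>2) * (a * N)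
      - k * (1 - \<alpha>)\<^sup>2 * a\<^sup>2"
    unfolding aA NH by (simp add: algebra_simps)
  finally show ?thesis
    using P_alpha_factor[OF refl a(1) k refl] unfolding Q by simp
qed

text \<open>One cherry and two pendant vertices already give \<open>2 * A + H \<le> a\<close>, that
  is \<open>H \<le> N\<close>, and \<open>H = \<beta>\<^sup>2 / N\<close> turns this into the
  assumption of \<open>heavy_subsolution\<close>.\<close>

lemma branch_weight_ge:
  fixes \<alpha> \<beta> a :: real
  assumes \<alpha>: "0 \<le> \<alpha>" and \<beta>: "0 < \<beta>" and a: "0 < a" and A: "A = \<alpha> + \<beta>\<^sup>2 / a"
    and N: "N = a - 2 * A" "0 < N" and H: "H = \<beta>\<^sup>2 / N"
    and k: "1 \<le> k" and c: "2 \<le> c" and ge: "c * A + k * (\<alpha> + H) \<le> \<alpha> + a"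
  shows "\<beta> \<le> N"
proof -
  have A0: "0 \<le> A" and H0: "0 \<le> H"
    unfolding A H using \<alpha> a N(2) by simp_all
  have "2 * A + 1 * (\<alpha> + H) \<le> c * A + k * (\<alpha> + H)"
    using A0 H0 \<alpha> k c by (intro add_mono mult_right_mono) auto
  from order_trans[OF this ge] have "2 * A + H \<le> a"
    by simp
  then have "H \<le> N"
    unfolding N(1) by (simp add: le_diff_eq add.commute)
  then have "\<beta>\<^sup>2 \<le> N\<^sup>2"
    unfolding H using N(2) by (simp add: divide_le_eq power2_eq_square)
  then show ?thesis
    using N(2) power2_le_imp_le[of \<beta> N] by linarith
qed

text \<open>\<open>p\<close> is the positive zero of \<open>a * N\<close>, which is a quadratic
  polynomial in \<open>a\<close>; it is the pole of \<open>H\<close>.\<close>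

lemma branch_pole:
  fixes \<alpha> \<beta> :: real
  assumes "0 \<le> \<alpha>" and "0 < \<beta>"
  obtains p where "0 < p" "p\<^sup>2 - 2 * \<alpha> * p - 2 * \<beta>\<^sup>2 = 0"
    "\<forall>a>p. 0 < a - 2 * (\<alpha> + \<beta>\<^sup>2 / a)"
proof
  define p where "p = \<alpha> + sqrt (\<alpha>\<^sup>2 + 2 * \<beta>\<^sup>2)"
  have sqrt_pos: "0 < sqrt (\<alpha>\<^sup>2 + 2 * \<beta>\<^sup>2)"
    using assms by (simp add: add_nonneg_pos)
  then show p_pos: "0 < p"
    unfolding p_def using assms by linarith
  have "(p - \<alpha>)\<^sup>2 = \<alpha>\<^sup>2 + 2 * \<beta>\<^sup>2"
    by (simp add: p_def)
  moreover have "(p - \<alpha>)\<^sup>2 = p\<^sup>2 - 2 * \<alpha> * p + \<alpha>\<^sup>2"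
    by (simp add: power2_eq_square algebra_simps)
  ultimately show p: "p\<^sup>2 - 2 * \<alpha> * p - 2 * \<beta>\<^sup>2 = 0"
    by linarith
  show "\<forall>a>p. 0 < a - 2 * (\<alpha> + \<beta>\<^sup>2 / a)"
  proof (intro allI impI)
    fix a assume a: "p < a"
    then have a_pos: "0 < a" and diff: "0 < a - p"
      using p_pos by linarith+
    have "0 < a + p - 2 * \<alpha>"
      using a sqrt_pos unfolding p_def by linarith
    with diff have "0 < (a - p) * (a + p - 2 * \<alpha>)"
      by (rule mult_pos_pos)
    also have "\<dots> = a\<^sup>2 - 2 * \<alpha> * a - (p\<^sup>2 - 2 * \<alpha> * p)"
      by (simp add: power2_eq_square algebra_simps)
    also have "\<dots> = a\<^sup>2 - 2 * \<alpha> * a - 2 * \<beta>\<^sup>2"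
      using p by linarith
    also have "\<dots> = a * (a - 2 * (\<alpha> + \<beta>\<^sup>2 / a))"
      using a_pos by (simp add: power2_eq_square algebra_simps)
    finally show "0 < a - 2 * (\<alpha> + \<beta>\<^sup>2 / a)"
      using a_pos by (rule zero_less_mult_pos)
  qed
qed

text \<open>The quadratic belongs to the star on \<open>n\<close> vertices and \<open>\<rho>\<close>
  is its larger zero. Its value at 1 is \<open>(1 - \<alpha>) * (2 - n) < 0\<close>, which places
  \<open>\<rho>\<close> beyond 1, the threshold for \<open>\<beta> < a\<close>.\<close>

lemma star_root:
  fixes \<alpha> :: real
  assumes \<alpha>: "0 \<le> \<alpha>" "\<alpha> < 1" and n: "3 \<le> n"
  obtains \<rho> where "1 < \<rho>" "(\<rho> - \<alpha> * (n - 1)) * (\<rho> - \<alpha>) - (n - 1) * (1 - \<alpha>)\<^sup>2 = 0"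
    "\<And>x. (x - \<alpha> * (n - 1)) * (x - \<alpha>) - (n - 1) * (1 - \<alpha>)\<^sup>2 \<le> 0 \<Longrightarrow> x \<le> \<rho>"
proof
  define d where "d = (\<alpha> * n)\<^sup>2 - 4 * ((n - 1) * (\<alpha>\<^sup>2 - (1 - \<alpha>)\<^sup>2))"
  define \<rho> where "\<rho> = (\<alpha> * n + sqrt d) / 2"
  define R where "R x = (x - \<alpha> * (n - 1)) * (x - \<alpha>) - (n - 1) * (1 - \<alpha>)\<^sup>2" for x
  have R: "4 * R x = (2 * x - \<alpha> * n)\<^sup>2 - d" for x
    unfolding R_def d_def by (simp add: power2_eq_square algebra_simps)
  have "R 1 = (1 - \<alpha>) * (2 - n)"
    unfolding R_def by (simp add: power2_eq_square algebra_simps)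
  then have R1: "R 1 < 0"
    using \<alpha> n by (simp add: mult_less_0_iff)
  then have d: "0 < d"
    using R[of 1] zero_le_power2[of "2 * 1 - \<alpha> * n"] by linarith
  show le: "x \<le> \<rho>" if "(x - \<alpha> * (n - 1)) * (x - \<alpha>) - (n - 1) * (1 - \<alpha>)\<^sup>2 \<le> 0" for x
  proof -
    have "(2 * x - \<alpha> * n)\<^sup>2 \<le> d"
      using that R[of x] by (simp add: R_def)
    then have "2 * x - \<alpha> * n \<le> sqrt d"
      by (rule real_le_rsqrt)
    then show ?thesis
      by (simp add: \<rho>_def)
  qed
  have "4 * R \<rho> = 0"
  proof -
    have "2 * \<rho> - \<alpha> * n = sqrt d"
      by (simp add: \<rho>_def add_divide_distrib)
    then show ?thesis
      unfolding R using d by simp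
  qed
  then show "(\<rho> - \<alpha> * (n - 1)) * (\<rho> - \<alpha>) - (n - 1) * (1 - \<alpha>)\<^sup>2 = 0"
    by (simp add: R_def)
  have "\<rho> \<noteq> 1"
    using R1 \<open>4 * R \<rho> = 0\<close> by auto
  then show "1 < \<rho>"
    using le[of 1] R1 by (simp add: R_def)
qed

section \<open>Simple trees as rooted trees\<close>

definition nbrs :: "'a pair_pre_digraph \<Rightarrow> 'a \<Rightarrow> 'a set" where
  "nbrs G v = {w. (v, w) \<in> parcs G}"

definition tree_arcs :: "'a set \<Rightarrow> 'a \<Rightarrow> ('a \<Rightarrow> 'a) \<Rightarrow> ('a \<times> 'a) set" where
  "tree_arcs V r par = (\<lambda>v. (par v, v)) ` (V - {r})"

lemma (in rooted_tree) root_reaches: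
  assumes "v \<in> V"
  shows "(r, v) \<in> (tree_arcs V r par)\<^sup>*"
  using assms
proof (induction "rank v" arbitrary: v rule: less_induct)
  case less
  show ?case
  proof (cases "v = r")
    case False
    then have v: "v \<in> V - {r}"
      using less.prems by simp
    then have "(r, par v) \<in> (tree_arcs V r par)\<^sup>*"
      using less.hyps rank_par_less par_in_V by blast
    moreover have "(par v, v) \<in> tree_arcs V r par"
      using v by (simp add: tree_arcs_def)
    ultimately show ?thesis
      by (rule rtrancl_into_rtrancl)
  qed simp
qed

lemma simple_treeD:
  assumes "simple_tree T"
  shows "finite (pverts T)" "parcs T \<subseteq> pverts T \<times> pverts T" "sym (parcs T)" "(v, v) \<notin> parcs T"
proof -
  interpret pair_graph T
    using assms by (simp add: simple_tree_def)
  show "finite (pverts T)"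
    by (rule pair_finite_verts)
  show "parcs T \<subseteq> pverts T \<times> pverts T"
    using wellformed' by auto
  show "sym (parcs T)"
    using pair_sym_arcs by (simp add: symmetric_def)
  show "(v, v) \<notin> parcs T"
    using pair_no_loops by fastforce
qed

text \<open>The library defines connectedness through the symmetric closure, which leaves a
  symmetric arc relation unchanged. A walk from \<open>r\<close> that never crosses the boundary of
  \<open>W\<close> cannot reach the rest.\<close>

lemma simple_tree_crossing_arc:
  assumes T: "simple_tree T" and r: "r \<in> W" and W: "W \<subset> pverts T"
  obtains u v where "u \<in> W" "v \<in> pverts T - W" "(u, v) \<in> parcs T"
proof (rule ccontr)
  assume no: "\<not> thesis"
  interpret pair_graph T
    using T by (simp add: simple_tree_def)
  obtain z where z: "z \<in> pverts T - W"
    using W by blast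
  have "parcs (mk_symmetric (with_proj T)) = parcs T"
    using simple_treeD(3)[OF T] by (force simp: mk_symmetric_def dest: symD)
  moreover have "r \<rightarrow>\<^sup>*\<^bsub>mk_symmetric (with_proj T)\<^esub> z"
    using T r W z unfolding simple_tree_def connected_def strongly_connected_def
    by (auto simp: mk_symmetric_def)
  ultimately have "(r, z) \<in> (parcs T)\<^sup>*"
    unfolding reachable_def by (auto dest!: rtrancl_on_rtranclI)
  then have "z \<in> W"
  proof (induction rule: rtrancl_induct)
    case (step y z)
    then show ?case
      using no that simple_treeD(2)[OF T] by blast
  qed (rule r)
  with z show False by simp
qed

lemma pawalk_verts_snoc: "pcas u p w \<Longrightarrow> pawalk_verts u (p @ [(w, v)]) = pawalk_verts u p @ [v]"
  by (induction p arbitrary: u) auto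

text \<open>For distinct \<open>u\<close> and \<open>u'\<close>, a path inside \<open>W\<close> is
  nonempty and closes through \<open>v\<close> to a cycle with at least three arcs. Taking the path
  in the subgraph on \<open>W\<close> keeps it away from \<open>v\<close>.\<close>

lemma simple_tree_two_nbrs_disconnected:
  assumes T: "simple_tree T" and W: "W \<subseteq> pverts T" and v: "v \<in> pverts T - W"
    and u: "u \<in> W" "(u, v) \<in> parcs T" and u': "u' \<in> W" "(u', v) \<in> parcs T"
    and path: "(u, u') \<in> (parcs T \<inter> W \<times> W)\<^sup>*"
  shows "u = u'"
proof (rule ccontr)
  assume neq: "u \<noteq> u'"
  interpret G: pair_graph T
    using T by (simp add: simple_tree_def)
  define S where "S = \<lparr>pverts = W, parcs = parcs T \<inter> W \<times> W\<rparr>"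
  interpret S: pair_wf_digraph S
    by unfold_locales (auto simp: S_def)
  have "u \<rightarrow>\<^sup>*\<^bsub>with_proj S\<^esub> u'"
    using path u(1) unfolding reachable_def
  proof (induction rule: rtrancl_induct)
    case base
    then show ?case
      by (auto simp: S_def intro: rtrancl_on_refl)
  next
    case (step y z)
    then show ?case
      by (auto simp: S_def intro: rtrancl_on_into_rtrancl_on)
  qed
  then obtain p where p: "S.apath u p u'"
    by (auto simp: S.reachable_apath)
  have sub: "subgraph (with_proj S) (with_proj T)"
    unfolding subgraph_def compatible_def using W S.wf_digraph_axioms G.wf_digraph_axioms
    by (auto simp: S_def)
  have awalk: "G.awalk u p u'"
    using p sub S.apath_def G.subgraph_awalk_imp_awalk by auto
  have verts: "set (pawalk_verts u p) \<subseteq> W" and dist: "distinct (pawalk_verts u p)"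
  proof -
    have "S.awalk u p u'" and dist': "distinct (pawalk_verts u p)"
      using p unfolding S.apath_def by simp_all
    then have "set (pawalk_verts u p) \<subseteq> pverts S"
      by (auto simp: S.awalk_def dest: S.awalk_verts_in_verts)
    then show "set (pawalk_verts u p) \<subseteq> W"
      by (simp add: S_def)
    show "distinct (pawalk_verts u p)"
      by (rule dist')
  qed
  have sym: "(v, u) \<in> parcs T"
    using u(2) simple_treeD(3)[OF T] by (auto dest: symD)
  define c where "c = (v, u) # p @ [(u', v)]"
  have "G.awalk u (p @ [(u', v)]) v"
    using awalk by (rule G.awalk_appendI) (use u'(2) G.in_arcsD1 G.in_arcsD2 in \<open>auto simp: G.awalk_def\<close>)
  then have "G.awalk v c v"
    using sym awalk by (auto simp: c_def G.awalk_Cons_iff)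
  moreover have "tl (pawalk_verts v c) = pawalk_verts u p @ [v]"
    using awalk by (simp add: c_def G.awalk_def pawalk_verts_snoc)
  ultimately have "G.cycle c"
    unfolding G.cycle_def using dist verts v by (auto simp: c_def)
  moreover have "p \<noteq> []"
    using awalk neq by (auto simp: G.awalk_def)
  then have "3 \<le> length c"
    by (cases p) (auto simp: c_def)
  ultimately show False
    using T by (auto simp: simple_tree_def)
qed

text \<open>A connected part of the tree grows by one vertex at a time: a new vertex adjacent to it
  has exactly one neighbour inside, which becomes its parent.\<close>

lemma simple_tree_grow:
  assumes T: "simple_tree T" and r: "r \<in> pverts T" and m: "m < card (pverts T)"
  shows "\<exists>W par rank. W \<subseteq> pverts T \<and> card W = Suc m \<and> rooted_tree W r par rank \<and>
    parcs T \<inter> W \<times> W = tree_arcs W r par \<union> (tree_arcs W r par)\<inverse>"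
  using m
proof (induction m)
  case 0
  have "rooted_tree {r} r (\<lambda>v. v) (\<lambda>_. 0)"
    by unfold_locales auto
  then show ?case
    using r simple_treeD(4)[OF T]
    by (intro exI[of _ "{r}"] exI[of _ "\<lambda>v. v"] exI[of _ "\<lambda>_. 0"]) (auto simp: tree_arcs_def)
next
  case (Suc m)
  then obtain W par rank where W: "W \<subseteq> pverts T" "card W = Suc m" "rooted_tree W r par rank"
    and arcs: "parcs T \<inter> W \<times> W = tree_arcs W r par \<union> (tree_arcs W r par)\<inverse>"
    by auto
  interpret W: rooted_tree W r par rank
    by (rule W(3))
  have "W \<noteq> pverts T"
    using W(2) Suc.prems by auto
  then obtain u v where uv: "u \<in> W" "v \<in> pverts T - W" "(u, v) \<in> parcs T"
    using simple_tree_crossing_arc[OF T W.root_in_V] W(1) by blast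
  have reach: "(y, z) \<in> (parcs T \<inter> W \<times> W)\<^sup>*" if "y \<in> W" "z \<in> W" for y z
  proof -
    have "(r, z) \<in> (parcs T \<inter> W \<times> W)\<^sup>*"
      unfolding arcs using W.root_reaches[OF that(2)] by (meson in_rtrancl_UnI)
    moreover have "(y, r) \<in> (parcs T \<inter> W \<times> W)\<^sup>*"
      unfolding arcs using W.root_reaches[OF that(1)] by (meson in_rtrancl_UnI rtrancl_converseI)
    ultimately show ?thesis
      by (meson rtrancl_trans)
  qed
  have uniq: "w = u" if "w \<in> W" "(w, v) \<in> parcs T" for w
    using simple_tree_two_nbrs_disconnected[OF T W(1) uv(2) that uv(1,3)] reach[OF that(1) uv(1)] by blast
  have v_W: "v \<notin> W" and v_r: "v \<noteq> r"
    using uv(2) W.root_in_V by auto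
  have tree: "rooted_tree (insert v W) r (par(v := u)) (rank(v := Suc (rank u)))"
  proof
    show "finite (insert v W)"
      using W.finite_V by simp
    show "r \<in> insert v W"
      using W.root_in_V by simp
    fix w assume w: "w \<in> insert v W - {r}"
    show "(par(v := u)) w \<in> insert v W"
      using w uv(1) W.par_in_V by auto
    show "(rank(v := Suc (rank u))) ((par(v := u)) w) < (rank(v := Suc (rank u))) w"
      using w uv(1) v_W W.par_in_V[of w] W.rank_par_less[of w] by auto
  qed
  have new_arcs: "tree_arcs (insert v W) r (par(v := u)) = insert (u, v) (tree_arcs W r par)"
    using v_W v_r unfolding tree_arcs_def by (auto simp: insert_Diff_if)
  have restrict: "parcs T \<inter> insert v W \<times> insert v W = (parcs T \<inter> W \<times> W) \<union> {(u, v), (v, u)}"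
  proof -
    have in_v: "(w, v) \<in> parcs T \<longleftrightarrow> w = u" if "w \<in> W" for w
      using uniq[OF that] uv(3) by blast
    have "(v, w) \<in> parcs T \<longleftrightarrow> (w, v) \<in> parcs T" for w
      using simple_treeD(3)[OF T] unfolding sym_def by blast
    with in_v have out_v: "(v, w) \<in> parcs T \<longleftrightarrow> w = u" if "w \<in> W" for w
      using that by simp
    show ?thesis
      using in_v out_v simple_treeD(4)[OF T, of v] uv(1) by auto
  qed
  show ?case
  proof (intro exI conjI)
    show "rooted_tree (insert v W) r (par(v := u)) (rank(v := Suc (rank u)))"
      by (rule tree)
    show "parcs T \<inter> insert v W \<times> insert v W =
        tree_arcs (insert v W) r (par(v := u)) \<union> (tree_arcs (insert v W) r (par(v := u)))\<inverse>"
      unfolding restrict new_arcs arcs by blast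
    show "insert v W \<subseteq> pverts T"
      using W(1) uv(2) by blast
    show "card (insert v W) = Suc (Suc m)"
      using W(2) v_W W.finite_V by simp
  qed
qed

lemma simple_tree_rooted:
  assumes T: "simple_tree T" and r: "r \<in> pverts T"
  obtains par rank where "rooted_tree (pverts T) r par rank"
    "parcs T = tree_arcs (pverts T) r par \<union> (tree_arcs (pverts T) r par)\<inverse>"
proof -
  have fin: "finite (pverts T)"
    using simple_treeD(1)[OF T] .
  then have "0 < card (pverts T)"
    using r card_gt_0_iff by blast
  then obtain W par rank where W: "W \<subseteq> pverts T" "card W = card (pverts T)"
      "rooted_tree W r par rank" "parcs T \<inter> W \<times> W = tree_arcs W r par \<union> (tree_arcs W r par)\<inverse>"
    using simple_tree_grow[OF T r, of "card (pverts T) - 1"] by auto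
  have "W = pverts T"
    using card_subset_eq[OF fin W(1,2)] .
  moreover have "parcs T \<inter> pverts T \<times> pverts T = parcs T"
    using simple_treeD(2)[OF T] by blast
  ultimately show thesis
    using that W by simp
qed

locale rooted_graph = rooted_tree "pverts T" r par rank
  for T :: "'a pair_pre_digraph" and r par rank +
  assumes arcs: "parcs T = tree_arcs (pverts T) r par \<union> (tree_arcs (pverts T) r par)\<inverse>"
begin

lemma nbrs_eq: "v \<in> pverts T \<Longrightarrow> nbrs T v = ch v \<union> (if v = r then {} else {par v})"
  by (auto simp: nbrs_def arcs tree_arcs_def ch_def)

lemma par_notin_ch: "v \<in> pverts T - {r} \<Longrightarrow> par v \<notin> ch v"
  using rank_par_less[of v] rank_par_less[of "par v"] by (auto simp: ch_def)

lemma sum_nbrs: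
  fixes f :: "'a \<Rightarrow> real"
  assumes "v \<in> pverts T"
  shows "(\<Sum>w\<in>nbrs T v. f w) = (\<Sum>w\<in>ch v. f w) + (if v = r then 0 else f (par v))"
  using assms par_notin_ch[of v] by (auto simp: nbrs_eq)

lemma card_nbrs: "v \<in> pverts T \<Longrightarrow> card (nbrs T v) = card (ch v) + (if v = r then 0 else 1)"
  using par_notin_ch[of v] by (simp add: nbrs_eq)

lemma sum_card_ch: "(\<Sum>v\<in>pverts T. card (ch v)) + 1 = card (pverts T)"
proof -
  have "(\<Sum>v\<in>pverts T. \<Sum>w\<in>ch v. 1::real) = (\<Sum>w\<in>pverts T - {r}. 1)"
    by (rule sum_ch)
  then have "real (\<Sum>v\<in>pverts T. card (ch v)) = real (card (pverts T - {r}))"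
    by simp
  moreover have "card (pverts T - {r}) + 1 = card (pverts T)"
    using finite_V root_in_V by (metis Suc_eq_plus1 card_Suc_Diff1)
  ultimately show ?thesis
    by linarith
qed

text \<open>A vertex other than the root spends its only neighbour on its parent, so all children
  belong to the root, which has at most one.\<close>

lemma small_if_degree_le_1:
  assumes "\<And>v. v \<in> pverts T \<Longrightarrow> card (nbrs T v) \<le> 1"
  shows "card (pverts T) \<le> 2"
proof -
  have "(\<Sum>v\<in>pverts T - {r}. card (ch v)) = 0"
  proof (rule sum.neutral, rule ballI)
    fix v assume "v \<in> pverts T - {r}"
    then have v: "v \<in> pverts T" "v \<noteq> r"
      by simp_all
    show "card (ch v) = 0"
      using assms[OF v(1)] card_nbrs[OF v(1)] v(2) by simp
  qed
  moreover have "(\<Sum>v\<in>pverts T. card (ch v)) = card (ch r) + (\<Sum>v\<in>pverts T - {r}. card (ch v))"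
    using finite_V root_in_V by (rule sum.remove)
  moreover have "card (ch r) \<le> 1"
    using assms[OF root_in_V] card_nbrs[OF root_in_V] by simp
  ultimately show ?thesis
    using sum_card_ch by linarith
qed

end

section \<open>Degrees and dissociation sets in terms of neighbourhoods\<close>

lemma degree_induce_subgraph:
  assumes "v \<in> S"
  shows "out_degree (with_proj G \<restriction> S) v = card (nbrs G v \<inter> S)"
proof -
  have "out_arcs (with_proj G \<restriction> S) v = Pair v ` (nbrs G v \<inter> S)"
    using assms by (auto simp: out_arcs_def induce_subgraph_def nbrs_def)
  then show ?thesis
    by (simp add: out_degree_def card_image inj_on_def)
qed

lemma degree_of_eq: "degree_of G v = card (nbrs G v)"
proof -
  have "out_arcs (with_proj G) v = Pair v ` nbrs G v"
    by (auto simp: out_arcs_def nbrs_def)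
  then show ?thesis
    by (simp add: out_degree_def card_image inj_on_def)
qed

lemma dissociation_set_iff:
  "dissociation_set G S \<longleftrightarrow> S \<subseteq> pverts G \<and> (\<forall>v\<in>S. card (nbrs G v \<inter> S) \<le> 1)"
  by (auto simp: dissociation_set_def degree_induce_subgraph)

lemma dissociation_number_ge:
  assumes "finite (pverts G)" "dissociation_set G S"
  shows "card S \<le> dissociation_number G"
proof -
  have "{S. dissociation_set G S} \<subseteq> Pow (pverts G)"
    by (auto simp: dissociation_set_def)
  then have "finite {S. dissociation_set G S}"
    using assms(1) finite_subset by blast
  then show ?thesis
    unfolding dissociation_number_def using assms(2) by (intro Max_ge) auto
qed

lemma dissociation_number_attained:
  assumes "finite (pverts G)"
  obtains S where "dissociation_set G S" "card S = dissociation_number G"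
proof -
  have "{S. dissociation_set G S} \<subseteq> Pow (pverts G)"
    by (auto simp: dissociation_set_def)
  then have "finite {S. dissociation_set G S}"
    using assms finite_subset by blast
  moreover have "dissociation_set G {}"
    by (simp add: dissociation_set_def)
  ultimately have "dissociation_number G \<in> card ` {S. dissociation_set G S}"
    unfolding dissociation_number_def by (intro Max_in) auto
  then show thesis
    using that by auto
qed

context rooted_graph
begin

lemma card_cut_ge: "card (pverts T) \<le> card {v \<in> pverts T. cut v} + dissociation_number T"
proof -
  let ?S = "{v \<in> pverts T. \<not> cut v}"
  have "card (nbrs T v \<inter> ?S) \<le> 1" if "v \<in> ?S" for v
  proof -
    have "nbrs T v \<inter> ?S = {w \<in> ch v. \<not> cut w} \<union> (if v \<noteq> r \<and> \<not> cut (par v) then {par v} else {})"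
      using that par_in_V[of v] ch_in_V[of _ v] by (auto simp: nbrs_eq split: if_splits)
    then show ?thesis
      using uncut_degree_le_one[of v] that by simp
  qed
  then have "card ?S \<le> dissociation_number T"
    using finite_V by (intro dissociation_number_ge) (auto simp: dissociation_set_iff)
  moreover have "card (pverts T) = card {v \<in> pverts T. cut v} + card ?S"
    using finite_V by (subst card_Un_disjoint[symmetric]) (auto intro: arg_cong[where f = card])
  ultimately show ?thesis
    by simp
qed

lemma dissociation_number_less:
  assumes "3 \<le> card (pverts T)"
  shows "dissociation_number T < card (pverts T)"
proof (rule ccontr)
  assume ge: "\<not> ?thesis"
  obtain S where S: "dissociation_set T S" "card S = dissociation_number T"
    using dissociation_number_attained[OF finite_V] .
  then have sub: "S \<subseteq> pverts T"
    by (simp add: dissociation_set_def)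
  then have "S = pverts T"
    using S(2) ge finite_V by (intro card_seteq) auto
  moreover have "nbrs T v \<subseteq> pverts T" if "v \<in> pverts T" for v
    using that par_in_V[of v] ch_in_V by (auto simp: nbrs_eq)
  ultimately have "card (nbrs T v) \<le> 1" if "v \<in> pverts T" for v
    using S(1) that by (fastforce simp: dissociation_set_iff Int_absorb2)
  then show False
    using small_if_degree_le_1 assms by fastforce
qed

end

section \<open>Comparison with the extremal tree\<close>

text \<open>Arcs are pairs of vertices, so the arc map of an isomorphism is determined by the vertex
  map as \<open>map_prod f f\<close>.\<close>

lemma graph_isomorphicI:
  assumes wf: "parcs G \<subseteq> pverts G \<times> pverts G" and inj: "inj_on f (pverts G)"
    and verts: "f ` pverts G = pverts H" and arcs: "map_prod f f ` parcs G = parcs H"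
  shows "graph_isomorphic G H"
proof -
  let ?hom = "\<lparr>iso_verts = f, iso_arcs = map_prod f f, iso_head = snd, iso_tail = fst\<rparr>"
  have "wf_digraph (with_proj G)"
    using wf by unfold_locales auto
  moreover have "inj_on (map_prod f f) (parcs G)"
    using inj_on_subset[OF map_prod_inj_on[OF inj inj] wf] .
  ultimately have "pre_digraph.digraph_isomorphism (with_proj G) ?hom"
    using inj by (simp add: pre_digraph.digraph_isomorphism_def)
  moreover have "with_proj H = app_iso ?hom (with_proj G)"
    using verts arcs by (simp add: app_iso_def with_proj_def)
  ultimately show ?thesis
    unfolding graph_isomorphic_def digraph_iso_def by blast
qed

lemma graph_isomorphicE:
  assumes "graph_isomorphic G H"
  obtains f where "inj_on f (pverts G)" "f ` pverts G = pverts H" "map_prod f f ` parcs G = parcs H"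
proof -
  from assms obtain hom where hom: "pre_digraph.digraph_isomorphism (with_proj G) hom"
    "with_proj H = app_iso hom (with_proj G)"
    unfolding graph_isomorphic_def digraph_iso_def by blast
  have eqs: "pverts H = iso_verts hom ` pverts G" "parcs H = iso_arcs hom ` parcs G"
    "iso_tail hom = fst" "iso_head hom = snd"
    using hom(2) by (simp_all add: app_iso_def with_proj_def)
  have "iso_arcs hom e = map_prod (iso_verts hom) (iso_verts hom) e" if "e \<in> parcs G" for e
  proof -
    have "fst (iso_arcs hom e) = iso_verts hom (fst e)" "snd (iso_arcs hom e) = iso_verts hom (snd e)"
      using hom(1) that eqs(3,4) by (simp_all add: pre_digraph.digraph_isomorphism_def)
    then show ?thesis
      by (simp add: prod_eq_iff)
  qed
  then have "map_prod (iso_verts hom) (iso_verts hom) ` parcs G = parcs H"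
    using eqs(2) by (metis image_cong)
  then show thesis
    using that[of "iso_verts hom"] hom(1) eqs(1) by (simp add: pre_digraph.digraph_isomorphism_def)
qed

text \<open>Eigenvectors as functions on the vertices, free of the enumeration
  \<open>vertex_list\<close>; \<open>eigenvalue_A_alpha_iff\<close> gives the link to the
  matrix.\<close>

definition A_alpha_eigenfunction :: "real \<Rightarrow> 'a pair_pre_digraph \<Rightarrow> real \<Rightarrow> ('a \<Rightarrow> real) \<Rightarrow> bool" where
  "A_alpha_eigenfunction \<alpha> G l x \<longleftrightarrow> (\<exists>v\<in>pverts G. x v \<noteq> 0) \<and>
    (\<forall>v\<in>pverts G. l * x v = \<alpha> * card (nbrs G v) * x v + (1 - \<alpha>) * (\<Sum>w\<in>nbrs G v. x w))"

lemma A_alpha_eigenfunction_iso: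
  assumes iso: "graph_isomorphic G H" and wf: "parcs G \<subseteq> pverts G \<times> pverts G"
    and x: "A_alpha_eigenfunction \<alpha> H l x"
  shows "\<exists>y. A_alpha_eigenfunction \<alpha> G l y"
proof -
  obtain f where f: "inj_on f (pverts G)" "f ` pverts G = pverts H" "map_prod f f ` parcs G = parcs H"
    using graph_isomorphicE[OF iso] .
  have nbrs: "nbrs H (f v) = f ` nbrs G v" if v: "v \<in> pverts G" for v
  proof (intro equalityI subsetI)
    fix w assume "w \<in> nbrs H (f v)"
    then obtain u u' where u: "(u, u') \<in> parcs G" "f u = f v" "f u' = w"
      unfolding nbrs_def f(3)[symmetric] by auto
    then have "u = v"
      using f(1) v wf by (auto dest: inj_onD)
    with u show "w \<in> f ` nbrs G v"
      by (auto simp: nbrs_def)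
  next
    fix w assume "w \<in> f ` nbrs G v"
    then obtain u where "(v, u) \<in> parcs G" "w = f u"
      by (auto simp: nbrs_def)
    then show "w \<in> nbrs H (f v)"
      unfolding nbrs_def f(3)[symmetric] by force
  qed
  have inj: "inj_on f (nbrs G v)" for v
    by (rule inj_on_subset[OF f(1)]) (use wf in \<open>auto simp: nbrs_def\<close>)
  have "A_alpha_eigenfunction \<alpha> G l (x \<circ> f)"
    unfolding A_alpha_eigenfunction_def
  proof
    show "\<exists>v\<in>pverts G. (x \<circ> f) v \<noteq> 0"
    proof -
      obtain u where "u \<in> pverts H" "x u \<noteq> 0"
        using x unfolding A_alpha_eigenfunction_def by blast
      then show ?thesis
        unfolding f(2)[symmetric] by auto
    qed
    show "\<forall>v\<in>pverts G. l * (x \<circ> f) v =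
        \<alpha> * card (nbrs G v) * (x \<circ> f) v + (1 - \<alpha>) * (\<Sum>w\<in>nbrs G v. (x \<circ> f) w)"
    proof
      fix v assume v: "v \<in> pverts G"
      then have "f v \<in> pverts H"
        using f(2) by blast
      then have "l * x (f v) = \<alpha> * card (nbrs H (f v)) * x (f v) + (1 - \<alpha>) * (\<Sum>w\<in>nbrs H (f v). x w)"
        using x unfolding A_alpha_eigenfunction_def by blast
      then show "l * (x \<circ> f) v = \<alpha> * card (nbrs G v) * (x \<circ> f) v + (1 - \<alpha>) * (\<Sum>w\<in>nbrs G v. (x \<circ> f) w)"
        unfolding nbrs[OF v] card_image[OF inj] sum.reindex[OF inj] comp_def .
    qed
  qed
  then show ?thesis
    by blast
qed

lemma nbrs_sdagger:
  shows "nbrs (sdagger n \<tau>) (Star_Vertex 0) =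
      Star_Vertex ` {0<..<n - \<tau>} \<union> Centre_Pendant ` {..<3 * \<tau> + 2 - 2 * n}"
    and "0 < i \<Longrightarrow> i < n - \<tau> \<Longrightarrow>
      nbrs (sdagger n \<tau>) (Star_Vertex i) = insert (Star_Vertex 0) (Leaf_Pendant i ` {..<2})"
    and "0 < i \<Longrightarrow> i < n - \<tau> \<Longrightarrow> j < 2 \<Longrightarrow> nbrs (sdagger n \<tau>) (Leaf_Pendant i j) = {Star_Vertex i}"
    and "j < 3 * \<tau> + 2 - 2 * n \<Longrightarrow> nbrs (sdagger n \<tau>) (Centre_Pendant j) = {Star_Vertex 0}"
  by (auto simp: nbrs_def sdagger_def sdagger_edges_def)

text \<open>The eigenvector is 1 at the centre, \<open>\<beta> / N\<close> at the leaves of the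
  star, and \<open>\<beta> / a\<close> times the value of the neighbour at each pendant vertex. The
  equation at the centre is the assumption \<open>eq\<close>. If \<open>\<tau> + 1 = n\<close> the
  star has no leaves, so \<open>N\<close> is constrained only in the other case.\<close>

lemma sdagger_eigenfunction:
  fixes \<alpha> a A N H :: real
  assumes n: "\<tau> < n" "2 * n \<le> 3 * \<tau> + 2" and a: "0 < a"
    and A: "A = \<alpha> + (1 - \<alpha>)\<^sup>2 / a" and N: "N = a - 2 * A" and H: "H = (1 - \<alpha>)\<^sup>2 / N"
    and N_pos: "\<tau> + 1 < n \<Longrightarrow> 0 < N"
    and eq: "\<alpha> + a = (real n - 1) * A - (real n - real \<tau> - 1) * (3 * A - \<alpha> - H)"
  shows "\<exists>x. A_alpha_eigenfunction \<alpha> (sdagger n \<tau>) (\<alpha> + a) x"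
proof -
  define \<beta> where "\<beta> = 1 - \<alpha>"
  define x where "x v = (case v of Star_Vertex i \<Rightarrow> if i = 0 then 1 else \<beta> / N
    | Leaf_Pendant _ _ \<Rightarrow> \<beta> * (\<beta> / N) / a | Centre_Pendant _ \<Rightarrow> \<beta> / a)" for v
  have x: "x (Star_Vertex i) = (if i = 0 then 1 else \<beta> / N)" "x (Leaf_Pendant i j) = \<beta> * (\<beta> / N) / a"
    "x (Centre_Pendant j) = \<beta> / a" for i j
    by (simp_all add: x_def)
  define k where "k = real n - real \<tau> - 1"
  define c where "c = 3 * real \<tau> + 2 - 2 * real n"
  have cards: "real (n - \<tau> - 1) = k" "real (3 * \<tau> + 2 - 2 * n) = c"
    using n by (simp_all add: k_def c_def of_nat_diff)
  have centre: "\<alpha> + a = c * A + k * (\<alpha> + H)"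
    unfolding eq c_def k_def by (simp add: algebra_simps)
  have sum0: "(\<Sum>w\<in>nbrs (sdagger n \<tau>) (Star_Vertex 0). x w) = k * (\<beta> / N) + c * (\<beta> / a)"
    and card0: "card (nbrs (sdagger n \<tau>) (Star_Vertex 0)) = k + c"
  proof -
    have disj: "Star_Vertex ` {0<..<n - \<tau>} \<inter> Centre_Pendant ` {..<3 * \<tau> + 2 - 2 * n} = {}"
      by auto
    have inj: "inj_on Star_Vertex S" "inj_on Centre_Pendant S" for S
      by (simp_all add: inj_on_def)
    have sum: "(\<Sum>i\<in>{0<..<n - \<tau>}. x (Star_Vertex i)) = real (n - \<tau> - 1) * (\<beta> / N)"
      by (simp add: x)
    show "(\<Sum>w\<in>nbrs (sdagger n \<tau>) (Star_Vertex 0). x w) = k * (\<beta> / N) + c * (\<beta> / a)"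
      unfolding nbrs_sdagger using disj sum cards
      by (simp add: sum.union_disjoint sum.reindex inj x(3))
    show "card (nbrs (sdagger n \<tau>) (Star_Vertex 0)) = k + c"
      unfolding nbrs_sdagger using disj cards
      by (simp add: card_Un_disjoint card_image inj)
  qed
  have pendant: "(\<alpha> + a) * (\<beta> * y / a) = \<alpha> * (\<beta> * y / a) + \<beta> * y" for y
    using a by (simp add: distrib_right add_divide_distrib)
  have "A_alpha_eigenfunction \<alpha> (sdagger n \<tau>) (\<alpha> + a) x"
    unfolding A_alpha_eigenfunction_def
  proof
    show "\<exists>v\<in>pverts (sdagger n \<tau>). x v \<noteq> 0"
      using n by (intro bexI[of _ "Star_Vertex 0"]) (auto simp: x sdagger_def)
    show "\<forall>v\<in>pverts (sdagger n \<tau>). (\<alpha> + a) * x v = \<alpha> * card (nbrs (sdagger n \<tau>) v) * x v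
      + (1 - \<alpha>) * (\<Sum>w\<in>nbrs (sdagger n \<tau>) v. x w)"
    proof
      fix v assume "v \<in> pverts (sdagger n \<tau>)"
      then consider "v = Star_Vertex 0" | i where "v = Star_Vertex i" "0 < i" "i < n - \<tau>"
        | i j where "v = Leaf_Pendant i j" "0 < i" "i < n - \<tau>" "j < 2"
        | j where "v = Centre_Pendant j" "j < 3 * \<tau> + 2 - 2 * n"
        by (auto simp: sdagger_def)
      then show "(\<alpha> + a) * x v = \<alpha> * card (nbrs (sdagger n \<tau>) v) * x v
        + (1 - \<alpha>) * (\<Sum>w\<in>nbrs (sdagger n \<tau>) v. x w)"
      proof cases
        case 1
        show ?thesis
        proof -
          have "c * A + k * (\<alpha> + H) = \<alpha> * (k + c) + \<beta> * (k * (\<beta> / N) + c * (\<beta> / a))"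
            unfolding A H \<beta>_def[symmetric] by (simp add: power2_eq_square algebra_simps)
          then show ?thesis
            unfolding 1 sum0 card0 centre by (simp add: x(1) \<beta>_def)
        qed
      next
        case (2 i)
        then have "\<tau> + 1 < n"
          by linarith
        then have N: "N \<noteq> 0"
          using N_pos by blast
        have "card (insert (Star_Vertex 0) (Leaf_Pendant i ` {..<2})) = 3"
          by (simp add: card_insert_if card_image inj_on_def image_iff)
        moreover have "(\<Sum>w\<in>insert (Star_Vertex 0) (Leaf_Pendant i ` {..<2}). x w) =
            1 + 2 * (\<beta> * (\<beta> / N) / a)"
          by (simp add: sum.reindex inj_on_def image_iff x)
        moreover have "(\<alpha> + a) * (\<beta> / N) = \<alpha> * 3 * (\<beta> / N) + \<beta> * (1 + 2 * (\<beta> * (\<beta> / N) / a))"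
        proof -
          have "\<alpha> + a = N + (3 * \<alpha> + 2 * (\<beta>\<^sup>2 / a))"
            unfolding assms(5) A \<beta>_def by (simp add: algebra_simps)
          then have "(\<alpha> + a) * (\<beta> / N) = (N + (3 * \<alpha> + 2 * (\<beta>\<^sup>2 / a))) * (\<beta> / N)"
            by simp
          also have "\<dots> = \<beta> + (3 * \<alpha> + 2 * (\<beta>\<^sup>2 / a)) * (\<beta> / N)"
            unfolding distrib_right[of N] using N by simp
          also have "\<dots> = \<alpha> * 3 * (\<beta> / N) + \<beta> * (1 + 2 * (\<beta> * (\<beta> / N) / a))"
            by (simp add: power2_eq_square algebra_simps)
          finally show ?thesis .
        qed
        moreover have "x v = \<beta> / N"
          using 2 by (simp add: x(1))
        ultimately show ?thesis
          unfolding 2(1) nbrs_sdagger(2)[OF 2(2,3)] \<beta>_def[symmetric] by simp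
      next
        case (3 i j)
        then show ?thesis
          using pendant[of "\<beta> / N"] unfolding 3(1) nbrs_sdagger(3)[OF 3(2-4)] \<beta>_def[symmetric]
          by (simp add: x)
      next
        case (4 j)
        then show ?thesis
          using pendant[of 1] unfolding 4(1) nbrs_sdagger(4)[OF 4(2)] \<beta>_def[symmetric]
          by (simp add: x)
      qed
    qed
  qed
  then show ?thesis
    by blast
qed

context rooted_graph
begin

text \<open>\<open>C\<close> consists of the centres of the cherries. The number of pendant vertices
  at the root comes from counting: \<open>card (ch r) + 2 * card C + 1 = n\<close>. The vertex map
  is then assembled from bijections of the layers.\<close>

lemma isomorphic_sdagger:
  assumes C: "C \<subseteq> ch r" "\<And>c. c \<in> C \<Longrightarrow> card (ch c) = 2"
    and leaf: "\<And>c w. c \<in> C \<Longrightarrow> w \<in> ch c \<Longrightarrow> ch w = {}" "\<And>c. c \<in> ch r - C \<Longrightarrow> ch c = {}"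
    and n: "card (pverts T) = n" "\<tau> < n" "2 * n \<le> 3 * \<tau> + 2" and cardC: "card C = n - \<tau> - 1"
  shows "graph_isomorphic T (sdagger n \<tau>)"
proof -
  let ?V = "pverts T"
  let ?L = "ch r - C"
  have finC: "finite C"
    using C(1) finite_ch finite_subset by blast
  have cases: "v = r \<or> v \<in> C \<or> v \<in> ?L \<or> (\<exists>c\<in>C. v \<in> ch c)" if "v \<in> ?V" for v
    using that
  proof (induction "rank v" arbitrary: v rule: less_induct)
    case less
    show ?case
    proof (cases "v = r")
      case False
      then have v: "v \<in> ?V - {r}"
        using less.prems by simp
      have ch: "v \<in> ch (par v)"
        using v by (simp add: ch_def)
      have "par v = r \<or> par v \<in> C \<or> par v \<in> ?L \<or> (\<exists>c\<in>C. par v \<in> ch c)"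
        using less.hyps[OF rank_par_less[OF v] par_in_V[OF v]] .
      then show ?thesis
      proof (elim disjE bexE)
        assume "par v = r"
        with ch show ?thesis by auto
      next
        assume "par v \<in> ?L"
        with ch leaf(2) show ?thesis by blast
      next
        fix c assume "c \<in> C" "par v \<in> ch c"
        with ch leaf(1) show ?thesis by blast
      qed (use ch in blast)
    qed simp
  qed
  have ch_r: "v \<noteq> r \<and> v \<in> ?V \<and> par v = r" if "v \<in> ch r" for v
    using chD[OF that] by simp
  have ch_C: "v \<noteq> r \<and> v \<in> ?V \<and> v \<notin> ch r \<and> v \<notin> C \<and> par v = c" if "c \<in> C" "v \<in> ch c" for c v
    using chD[OF that(2)] ch_r[of c] C(1) that(1) by (auto simp: ch_def)
  have "card ?L = 3 * \<tau> + 2 - 2 * n"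
  proof -
    have "(\<Sum>v\<in>?V. card (ch v)) = (\<Sum>v\<in>insert r C. card (ch v))"
    proof (rule sum.mono_neutral_right[OF finite_V])
      show "insert r C \<subseteq> ?V"
        using root_in_V ch_r C(1) by auto
      show "\<forall>v\<in>?V - insert r C. card (ch v) = 0"
        using cases leaf by (metis DiffE card.empty insert_iff)
    qed
    also have "\<dots> = card (ch r) + 2 * card C"
      using finC C ch_r by (subst sum.insert) auto
    finally have "card (ch r) + 2 * card C + 1 = n"
      using sum_card_ch n(1) by simp
    moreover have "card ?L = card (ch r) - card C"
      using finC C(1) by (rule card_Diff_subset)
    ultimately show ?thesis
      using cardC n by linarith
  qed
  then obtain h where h: "bij_betw h ?L {..<3 * \<tau> + 2 - 2 * n}"
    using ex_bij_betw_finite_nat[of ?L] by (auto simp: lessThan_atLeast0)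
  have "card C = card {0<..<n - \<tau>}"
    using cardC by simp
  then obtain f where f: "bij_betw f C {0<..<n - \<tau>}"
    using finite_same_card_bij[OF finC finite_greaterThanLessThan] by blast
  have "\<forall>c\<in>C. \<exists>g. bij_betw g (ch c) {..<2::nat}"
  proof
    fix c assume "c \<in> C"
    then show "\<exists>g. bij_betw g (ch c) {..<2::nat}"
      using C(2) ex_bij_betw_finite_nat[OF finite_ch, of c] by (simp add: lessThan_atLeast0)
  qed
  then obtain g where g: "\<And>c. c \<in> C \<Longrightarrow> bij_betw (g c) (ch c) {..<2::nat}"
    by metis
  define \<phi> where "\<phi> v = (if v = r then Star_Vertex 0 else if v \<in> C then Star_Vertex (f v)
    else if v \<in> ch r then Centre_Pendant (h v) else Leaf_Pendant (f (par v)) (g (par v) v))" for v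
  have \<phi>_r: "\<phi> r = Star_Vertex 0"
    by (simp add: \<phi>_def)
  have \<phi>_C: "\<phi> v = Star_Vertex (f v)" if "v \<in> C" for v
    using that ch_r C(1) by (auto simp: \<phi>_def)
  have \<phi>_L: "\<phi> v = Centre_Pendant (h v)" if "v \<in> ?L" for v
    using that ch_r by (auto simp: \<phi>_def)
  have \<phi>_ch: "\<phi> v = Leaf_Pendant (f c) (g c v)" if "c \<in> C" "v \<in> ch c" for c v
    using ch_C[OF that] by (auto simp: \<phi>_def)
  have f_im: "f ` C = {0<..<n - \<tau>}" and h_im: "h ` ?L = {..<3 * \<tau> + 2 - 2 * n}"
    and g_im: "\<And>c. c \<in> C \<Longrightarrow> g c ` ch c = {..<2}"
    using f h g by (simp_all add: bij_betw_def)
  have V: "?V = insert r (C \<union> ?L \<union> (\<Union>c\<in>C. ch c))"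
  proof
    show "?V \<subseteq> insert r (C \<union> ?L \<union> (\<Union>c\<in>C. ch c))"
      using cases by blast
    show "insert r (C \<union> ?L \<union> (\<Union>c\<in>C. ch c)) \<subseteq> ?V"
      using root_in_V ch_r ch_C C(1) by blast
  qed
  have im_C: "\<phi> ` C = Star_Vertex ` {0<..<n - \<tau>}"
    unfolding f_im[symmetric] image_image using \<phi>_C by (rule image_cong[OF refl])
  have im_L: "\<phi> ` ?L = Centre_Pendant ` {..<3 * \<tau> + 2 - 2 * n}"
    unfolding h_im[symmetric] image_image using \<phi>_L by (rule image_cong[OF refl])
  have im_ch: "\<phi> ` ch c = Leaf_Pendant (f c) ` {..<2}" if "c \<in> C" for c
    unfolding g_im[OF that, symmetric] image_image using \<phi>_ch[OF that] by (rule image_cong[OF refl])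
  have im_ch_all: "(\<Union>c\<in>C. F (f c)) = (\<Union>i\<in>{0<..<n - \<tau>}. F i)" for F :: "nat \<Rightarrow> 'b set"
    unfolding f_im[symmetric] by simp
  show ?thesis
  proof (rule graph_isomorphicI)
    show "parcs T \<subseteq> ?V \<times> ?V"
      using par_in_V by (auto simp: arcs tree_arcs_def)
    show "inj_on \<phi> ?V"
    proof (rule inj_onI)
      fix u v assume u: "u \<in> ?V" and v: "v \<in> ?V" and eq: "\<phi> u = \<phi> v"
      have inj: "inj_on f C" "inj_on h ?L" "\<And>c. c \<in> C \<Longrightarrow> inj_on (g c) (ch c)"
        using f h g by (auto simp: bij_betw_def)
      have f_ne: "f c \<noteq> 0" if "c \<in> C" for c
        using f_im that by auto
      have g_inj: "u = v" if "c \<in> C" "u \<in> ch c" "d \<in> C" "v \<in> ch d" "f c = f d" "g c u = g d v" for c d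
      proof -
        have "c = d"
          using inj_onD[OF inj(1)] that by blast
        then show ?thesis
          using inj_onD[OF inj(3)[OF that(1)]] that by blast
      qed
      from cases[OF u] cases[OF v] show "u = v"
        using eq by (elim disjE bexE) (auto simp: \<phi>_r \<phi>_C \<phi>_L \<phi>_ch f_ne dest: f_ne g_inj
          inj_onD[OF inj(1)] inj_onD[OF inj(2)])
    qed
    have "\<phi> ` ?V = \<phi> ` insert r (C \<union> ?L \<union> (\<Union>c\<in>C. ch c))"
      using V by (rule arg_cong)
    also have "\<dots> = insert (\<phi> r) (\<phi> ` C \<union> \<phi> ` ?L \<union> (\<Union>c\<in>C. \<phi> ` ch c))"
      by (simp only: image_insert image_Un image_UN)
    also have "(\<Union>c\<in>C. \<phi> ` ch c) = (\<Union>c\<in>C. Leaf_Pendant (f c) ` {..<2})"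
      using im_ch by (rule SUP_cong[OF refl])
    also have "\<dots> = (\<Union>i\<in>{0<..<n - \<tau>}. Leaf_Pendant i ` {..<2})"
      by (rule im_ch_all)
    also have "insert (\<phi> r) (\<phi> ` C \<union> \<phi> ` ?L \<union> \<dots>) = insert (Star_Vertex 0) (Star_Vertex ` {0<..<n - \<tau>} \<union>
        Centre_Pendant ` {..<3 * \<tau> + 2 - 2 * n} \<union> (\<Union>i\<in>{0<..<n - \<tau>}. Leaf_Pendant i ` {..<2}))"
      by (simp only: im_C im_L \<phi>_r)
    also have "\<dots> = pverts (sdagger n \<tau>)"
      using n by (auto simp: sdagger_def)
    finally show "\<phi> ` ?V = pverts (sdagger n \<tau>)" .
    have "tree_arcs ?V r par = {r} \<times> C \<union> {r} \<times> ?L \<union> (\<Union>c\<in>C. {c} \<times> ch c)"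
    proof (intro equalityI subsetI)
      fix e assume "e \<in> tree_arcs ?V r par"
      then obtain v where v: "v \<in> ?V" "v \<noteq> r" "e = (par v, v)"
        unfolding tree_arcs_def by blast
      from cases[OF v(1)] show "e \<in> {r} \<times> C \<union> {r} \<times> ?L \<union> (\<Union>c\<in>C. {c} \<times> ch c)"
        using v(2,3) ch_r[of v] ch_C[of _ v] C(1) by blast
    next
      fix e assume "e \<in> {r} \<times> C \<union> {r} \<times> ?L \<union> (\<Union>c\<in>C. {c} \<times> ch c)"
      then obtain u v where "e = (u, v)" "v \<in> ch u"
        using C(1) by blast
      then show "e \<in> tree_arcs ?V r par"
        using chD[of v u] unfolding tree_arcs_def by blast
    qed
    then have "map_prod \<phi> \<phi> ` tree_arcs ?V r par =
        map_prod \<phi> \<phi> ` ({r} \<times> C \<union> {r} \<times> ?L \<union> (\<Union>c\<in>C. {c} \<times> ch c))"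
      by (rule arg_cong)
    also have "\<dots> = {\<phi> r} \<times> \<phi> ` C \<union> {\<phi> r} \<times> \<phi> ` ?L \<union> (\<Union>c\<in>C. {\<phi> c} \<times> \<phi> ` ch c)"
    proof -
      have "map_prod \<phi> \<phi> ` (X \<times> Y) = \<phi> ` X \<times> \<phi> ` Y" for X Y
        by (rule map_prod_surj_on[OF refl refl])
      then show ?thesis
        by (simp only: image_Un image_UN image_insert image_empty)
    qed
    also have "(\<Union>c\<in>C. {\<phi> c} \<times> \<phi> ` ch c) = (\<Union>c\<in>C. {Star_Vertex (f c)} \<times> Leaf_Pendant (f c) ` {..<2})"
      using im_ch \<phi>_C by (intro SUP_cong refl) (simp only:)
    also have "\<dots> = (\<Union>i\<in>{0<..<n - \<tau>}. {Star_Vertex i} \<times> Leaf_Pendant i ` {..<2})"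
      by (rule im_ch_all)
    also have "{\<phi> r} \<times> \<phi> ` C \<union> {\<phi> r} \<times> \<phi> ` ?L \<union> \<dots> = sdagger_edges n \<tau>"
      unfolding im_C im_L \<phi>_r sdagger_edges_def by auto
    finally have "map_prod \<phi> \<phi> ` tree_arcs ?V r par = sdagger_edges n \<tau>" .
    moreover have "map_prod \<phi> \<phi> ` (R\<inverse>) = (map_prod \<phi> \<phi> ` R)\<inverse>" for R
      by force
    ultimately show "map_prod \<phi> \<phi> ` parcs T = parcs (sdagger n \<tau>)"
      unfolding arcs image_Un by (simp add: sdagger_def)
  qed
qed

end

section \<open>Eigenvalues of the weighted adjacency matrix\<close>

text \<open>There is a complex eigenvalue \<open>\<mu>\<close> with an eigenvector \<open>v\<close>.
  The Hermitian form \<open>Z\<close> at \<open>v\<close> equals its conjugate by symmetry and is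
  \<open>\<mu>\<close> times the positive number \<open>S\<close>, so \<open>\<mu>\<close> is real.
  This makes the set under \<open>Max\<close> in \<open>A_alpha_index\<close> nonempty.\<close>

lemma real_symmetric_eigenvalue_exists:
  fixes M :: "real mat"
  assumes M: "M \<in> carrier_mat n n" and n: "0 < n"
    and sym: "\<And>i j. i < n \<Longrightarrow> j < n \<Longrightarrow> M $$ (i, j) = M $$ (j, i)"
  shows "\<exists>l. eigenvalue M l"
proof -
  define C where "C = map_mat complex_of_real M"
  have C: "C \<in> carrier_mat n n"
    using M by (simp add: C_def)
  have "\<not> constant (poly (char_poly C))"
    using degree_monic_char_poly[OF C] n by (simp add: constant_degree)
  then obtain \<mu> where \<mu>: "poly (char_poly C) \<mu> = 0"
    using fundamental_theorem_of_algebra by blast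
  then have "eigenvalue C \<mu>"
    using eigenvalue_root_char_poly[OF C] by simp
  then obtain v where v: "v \<in> carrier_vec n" "v \<noteq> 0\<^sub>v n" "C *\<^sub>v v = \<mu> \<cdot>\<^sub>v v"
    using C by (auto simp: eigenvalue_def eigenvector_def)
  have row: "(\<Sum>j<n. C $$ (i, j) * v $ j) = \<mu> * v $ i" if "i < n" for i
  proof -
    have "(C *\<^sub>v v) $ i = (\<mu> \<cdot>\<^sub>v v) $ i"
      using v(3) by simp
    then show ?thesis
      using that C v(1) by (simp add: scalar_prod_def row_def lessThan_atLeast0)
  qed
  define Z where "Z = (\<Sum>i<n. \<Sum>j<n. cnj (v $ i) * C $$ (i, j) * v $ j)"
  define S where "S = (\<Sum>i<n. (cmod (v $ i))\<^sup>2)"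
  have Z: "Z = \<mu> * of_real S"
  proof -
    have "Z = (\<Sum>i<n. cnj (v $ i) * (\<Sum>j<n. C $$ (i, j) * v $ j))"
      unfolding Z_def by (simp add: sum_distrib_left mult.assoc)
    also have "\<dots> = (\<Sum>i<n. \<mu> * (v $ i * cnj (v $ i)))"
      using row by (intro sum.cong) (simp_all add: mult_ac)
    also have "\<dots> = \<mu> * of_real S"
      unfolding S_def of_real_sum sum_distrib_left complex_norm_square[symmetric] by simp
    finally show ?thesis .
  qed
  have "cnj Z = (\<Sum>i<n. \<Sum>j<n. v $ i * C $$ (i, j) * cnj (v $ j))"
    using M by (simp add: Z_def C_def)
  also have "\<dots> = (\<Sum>j<n. \<Sum>i<n. v $ i * C $$ (i, j) * cnj (v $ j))"
    by (rule sum.swap)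
  also have "\<dots> = Z"
    unfolding Z_def using M sym by (intro sum.cong refl) (simp add: C_def mult_ac)
  finally have "cnj Z = Z" .
  moreover have "0 < S"
  proof -
    obtain i where i: "i < n" "v $ i \<noteq> 0"
      using v(1,2) by (metis eq_vecI carrier_vecD index_zero_vec)
    then have "0 < (cmod (v $ i))\<^sup>2"
      by simp
    also have "\<dots> \<le> S"
      unfolding S_def using i by (intro member_le_sum) auto
    finally show ?thesis .
  qed
  ultimately have "cnj \<mu> = \<mu>"
    using Z by simp
  then obtain l where l: "\<mu> = of_real l"
    by (metis Reals_cases Reals_cnj_iff)
  have "char_poly C = map_poly of_real (char_poly M)"
    unfolding C_def by (rule of_real_hom.char_poly_hom[OF M])
  then have "poly (char_poly M) l = 0"
    using \<mu> l by simp
  then show ?thesis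
    using eigenvalue_root_char_poly[OF M] by blast
qed

lemma finite_eigenvalues:
  fixes M :: "real mat"
  assumes "M \<in> carrier_mat n n"
  shows "finite {l. eigenvalue M l}"
proof -
  have "char_poly M \<noteq> 0"
    using degree_monic_char_poly[OF assms] by auto
  then show ?thesis
    using poly_roots_finite eigenvalue_root_char_poly[OF assms] by auto
qed

lemma vertex_list:
  assumes "finite (pverts G)"
  shows "distinct (vertex_list G)" "set (vertex_list G) = pverts G"
    "length (vertex_list G) = graph_order G"
proof -
  have "\<exists>vs. distinct vs \<and> set vs = pverts G"
    using finite_distinct_list[OF assms] by blast
  then have "distinct (vertex_list G) \<and> set (vertex_list G) = pverts G"
    unfolding vertex_list_def by (rule someI_ex)
  then show "distinct (vertex_list G)" "set (vertex_list G) = pverts G"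
      "length (vertex_list G) = graph_order G"
    using distinct_card[of "vertex_list G"] by (auto simp: graph_order_def)
qed

lemma A_alpha_carrier: "A_alpha \<alpha> G \<in> carrier_mat (graph_order G) (graph_order G)"
  by (simp add: A_alpha_def degree_matrix_def adjacency_matrix_def)

lemma A_alpha_entry:
  assumes "i < graph_order G" "j < graph_order G"
  shows "A_alpha \<alpha> G $$ (i, j) = (if i = j then \<alpha> * card (nbrs G (vertex_list G ! i)) else 0) +
    (if vertex_list G ! j \<in> nbrs G (vertex_list G ! i) then 1 - \<alpha> else 0)"
  using assms by (simp add: A_alpha_def degree_matrix_def adjacency_matrix_def nbrs_def degree_of_eq)

lemma A_alpha_mult_vec:
  assumes fin: "finite (pverts G)" and arcs: "parcs G \<subseteq> pverts G \<times> pverts G"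
    and i: "i < graph_order G"
  shows "(A_alpha \<alpha> G *\<^sub>v vec (graph_order G) (\<lambda>j. x (vertex_list G ! j))) $ i =
    \<alpha> * card (nbrs G (vertex_list G ! i)) * x (vertex_list G ! i) +
    (1 - \<alpha>) * (\<Sum>w\<in>nbrs G (vertex_list G ! i). x w)"
proof -
  let ?n = "graph_order G" and ?u = "vertex_list G ! i"
  have "(A_alpha \<alpha> G *\<^sub>v vec ?n (\<lambda>j. x (vertex_list G ! j))) $ i =
      (\<Sum>j<?n. A_alpha \<alpha> G $$ (i, j) * x (vertex_list G ! j))"
    using i carrier_matD[OF A_alpha_carrier[of \<alpha> G]] by (simp add: scalar_prod_def row_def lessThan_atLeast0)
  also have "\<dots> = (\<Sum>j<?n. (if i = j then \<alpha> * card (nbrs G ?u) * x ?u else 0) +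
      (if vertex_list G ! j \<in> nbrs G ?u then (1 - \<alpha>) * x (vertex_list G ! j) else 0))"
    using i by (intro sum.cong refl) (auto simp: A_alpha_entry algebra_simps)
  also have "\<dots> = \<alpha> * card (nbrs G ?u) * x ?u +
      (\<Sum>j<?n. if vertex_list G ! j \<in> nbrs G ?u then (1 - \<alpha>) * x (vertex_list G ! j) else 0)"
    using i by (simp add: sum.distrib)
  also have "(\<Sum>j<?n. if vertex_list G ! j \<in> nbrs G ?u then (1 - \<alpha>) * x (vertex_list G ! j) else 0) =
      (\<Sum>w\<in>pverts G. if w \<in> nbrs G ?u then (1 - \<alpha>) * x w else 0)"
    using bij_betw_nth[OF vertex_list(1)[OF fin]] vertex_list(2,3)[OF fin]
    by (intro sum.reindex_bij_betw) (auto simp: lessThan_def)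
  also have "\<dots> = (\<Sum>w\<in>{w \<in> pverts G. w \<in> nbrs G ?u}. (1 - \<alpha>) * x w)"
    using fin by (rule sum.inter_filter[symmetric])
  also have "{w \<in> pverts G. w \<in> nbrs G ?u} = nbrs G ?u"
    using arcs by (auto simp: nbrs_def)
  finally show ?thesis
    by (simp add: sum_distrib_left)
qed

lemma eigenvalue_A_alpha_iff:
  assumes fin: "finite (pverts G)" and arcs: "parcs G \<subseteq> pverts G \<times> pverts G"
  shows "eigenvalue (A_alpha \<alpha> G) l \<longleftrightarrow> (\<exists>x. A_alpha_eigenfunction \<alpha> G l x)"
proof
  let ?n = "graph_order G" and ?vs = "vertex_list G"
  note vs = vertex_list[OF fin]
  note dim = carrier_matD[OF A_alpha_carrier[of \<alpha> G]]
  {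
    assume "eigenvalue (A_alpha \<alpha> G) l"
    then obtain v where v: "v \<in> carrier_vec ?n" "v \<noteq> 0\<^sub>v ?n" "A_alpha \<alpha> G *\<^sub>v v = l \<cdot>\<^sub>v v"
      using dim by (auto simp: eigenvalue_def eigenvector_def)
    define x where "x w = v $ (inv_into {..<?n} ((!) ?vs) w)" for w
    have bij: "bij_betw ((!) ?vs) {..<?n} (pverts G)"
      using bij_betw_nth[OF vs(1)] vs(2,3) by auto
    have x: "x (?vs ! i) = v $ i" if "i < ?n" for i
      using that bij by (simp add: x_def bij_betw_def)
    have v_eq: "v = vec ?n (\<lambda>j. x (?vs ! j))"
      using v(1) x by (intro eq_vecI) auto
    have ex: "\<exists>i<?n. w = ?vs ! i" if "w \<in> pverts G" for w
      using that vs(2,3) by (metis in_set_conv_nth)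
    have "A_alpha_eigenfunction \<alpha> G l x"
      unfolding A_alpha_eigenfunction_def
    proof
      obtain i where i: "i < ?n" "v $ i \<noteq> 0"
        using v(1,2) by (metis eq_vecI carrier_vecD index_zero_vec)
      then show "\<exists>w\<in>pverts G. x w \<noteq> 0"
        using x[OF i(1)] vs(2,3) nth_mem[of i ?vs] by (intro bexI[of _ "?vs ! i"]) auto
      show "\<forall>w\<in>pverts G. l * x w = \<alpha> * card (nbrs G w) * x w + (1 - \<alpha>) * (\<Sum>u\<in>nbrs G w. x u)"
      proof
        fix w assume "w \<in> pverts G"
        then obtain i where i: "i < ?n" "w = ?vs ! i"
          using ex by blast
        have "(A_alpha \<alpha> G *\<^sub>v vec ?n (\<lambda>j. x (?vs ! j))) $ i = l * x w"
          using v(1,3) i x unfolding v_eq[symmetric] by simp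
        then show "l * x w = \<alpha> * card (nbrs G w) * x w + (1 - \<alpha>) * (\<Sum>u\<in>nbrs G w. x u)"
          unfolding A_alpha_mult_vec[OF fin arcs i(1)] i(2) by simp
      qed
    qed
    then show "\<exists>x. A_alpha_eigenfunction \<alpha> G l x"
      by blast
  }
  assume "\<exists>x. A_alpha_eigenfunction \<alpha> G l x"
  then obtain x w where x: "w \<in> pverts G" "x w \<noteq> 0"
    "\<And>w. w \<in> pverts G \<Longrightarrow> l * x w = \<alpha> * card (nbrs G w) * x w + (1 - \<alpha>) * (\<Sum>u\<in>nbrs G w. x u)"
    unfolding A_alpha_eigenfunction_def by blast
  define v where "v = vec ?n (\<lambda>j. x (?vs ! j))"
  obtain i where i: "i < ?n" "w = ?vs ! i"
    using x(1) vs(2,3) by (metis in_set_conv_nth)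
  then have "v $ i \<noteq> 0"
    using x(2) by (simp add: v_def)
  then have "v \<noteq> 0\<^sub>v ?n"
    using i(1) by auto
  moreover have "A_alpha \<alpha> G *\<^sub>v v = l \<cdot>\<^sub>v v"
  proof (rule eq_vecI)
    fix i assume "i < dim_vec (l \<cdot>\<^sub>v v)"
    then have i: "i < ?n"
      by (simp add: v_def)
    then have "?vs ! i \<in> pverts G"
      using vs(2,3) nth_mem by metis
    from x(3)[OF this] show "(A_alpha \<alpha> G *\<^sub>v v) $ i = (l \<cdot>\<^sub>v v) $ i"
      using i unfolding v_def A_alpha_mult_vec[OF fin arcs i] by simp
  qed (use dim in \<open>simp add: v_def\<close>)
  moreover have "v \<in> carrier_vec ?n"
    by (simp add: v_def)
  ultimately show "eigenvalue (A_alpha \<alpha> G) l"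
    using dim unfolding eigenvalue_def eigenvector_def by auto
qed

lemma A_alpha_index:
  assumes fin: "finite (pverts G)" and ne: "pverts G \<noteq> {}" and sym: "sym (parcs G)"
  shows "eigenvalue (A_alpha \<alpha> G) (A_alpha_index \<alpha> G)"
    and "eigenvalue (A_alpha \<alpha> G) l \<Longrightarrow> l \<le> A_alpha_index \<alpha> G"
proof -
  have finite: "finite {l. eigenvalue (A_alpha \<alpha> G) l}"
    using finite_eigenvalues[OF A_alpha_carrier] .
  have pos: "0 < graph_order G"
    using fin ne by (simp add: graph_order_def card_gt_0_iff)
  have symmetric: "A_alpha \<alpha> G $$ (i, j) = A_alpha \<alpha> G $$ (j, i)"
    if "i < graph_order G" "j < graph_order G" for i j
    using that sym by (auto simp: A_alpha_entry nbrs_def dest: symD)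
  have "\<exists>l. eigenvalue (A_alpha \<alpha> G) l"
    by (rule real_symmetric_eigenvalue_exists[OF A_alpha_carrier pos symmetric])
  then have "A_alpha_index \<alpha> G \<in> {l. eigenvalue (A_alpha \<alpha> G) l}"
    unfolding A_alpha_index_def using finite by (intro Max_in) auto
  then show "eigenvalue (A_alpha \<alpha> G) (A_alpha_index \<alpha> G)"
    by simp
  show "l \<le> A_alpha_index \<alpha> G" if "eigenvalue (A_alpha \<alpha> G) l"
    unfolding A_alpha_index_def using finite that by (intro Max_ge) auto
qed

section \<open>The index of a tree\<close>

lemma eigenfunction_subsolution:
  assumes T: "simple_tree T" and \<alpha>: "0 \<le> \<alpha>" "\<alpha> < 1" and l: "1 < l"
    and x: "A_alpha_eigenfunction \<alpha> T l x"
  obtains r par rank z where "rooted_graph T r par rank"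
    "subsolution (pverts T) r par rank \<alpha> (1 - \<alpha>) (l - \<alpha>) z"
    "l \<le> (\<Sum>c\<in>rooted_tree.ch (pverts T) r par r. \<alpha> + (1 - \<alpha>) * z c)"
proof -
  let ?V = "pverts T"
  have fin: "finite ?V"
    using simple_treeD(1)[OF T] .
  obtain u where u: "u \<in> ?V" "x u \<noteq> 0"
    using x unfolding A_alpha_eigenfunction_def by blast
  then have "Max ((\<lambda>v. \<bar>x v\<bar>) ` ?V) \<in> (\<lambda>v. \<bar>x v\<bar>) ` ?V"
    using fin by (intro Max_in) auto
  then obtain r where r: "r \<in> ?V" "\<bar>x r\<bar> = Max ((\<lambda>v. \<bar>x v\<bar>) ` ?V)"
    by auto
  have max: "\<bar>x v\<bar> \<le> \<bar>x r\<bar>" if "v \<in> ?V" for v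
    unfolding r(2) using fin that by (intro Max_ge) auto
  have xr: "0 < \<bar>x r\<bar>"
    using max[OF u(1)] u(2) by linarith
  obtain par rank where tree: "rooted_tree ?V r par rank"
    and arcs: "parcs T = tree_arcs ?V r par \<union> (tree_arcs ?V r par)\<inverse>"
    using simple_tree_rooted[OF T r(1)] .
  have G: "rooted_graph T r par rank"
    unfolding rooted_graph_def rooted_graph_axioms_def using tree arcs by blast
  interpret rooted_graph T r par rank
    by (rule G)
  define z where "z v = \<bar>x v\<bar> / \<bar>x r\<bar>" for v
  have z: "l * z v \<le> \<alpha> * card (nbrs T v) * z v + (1 - \<alpha>) * (\<Sum>w\<in>nbrs T v. z w)" if v: "v \<in> ?V" for v
  proof -
    have "l * \<bar>x v\<bar> = \<bar>l * x v\<bar>"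
      using l by (simp add: abs_mult)
    also have "\<dots> = \<bar>\<alpha> * card (nbrs T v) * x v + (1 - \<alpha>) * (\<Sum>w\<in>nbrs T v. x w)\<bar>"
      using x v unfolding A_alpha_eigenfunction_def by simp
    also have "\<dots> \<le> \<bar>\<alpha> * card (nbrs T v) * x v\<bar> + \<bar>(1 - \<alpha>) * (\<Sum>w\<in>nbrs T v. x w)\<bar>"
      by (rule abs_triangle_ineq)
    also have "\<dots> \<le> \<alpha> * card (nbrs T v) * \<bar>x v\<bar> + (1 - \<alpha>) * (\<Sum>w\<in>nbrs T v. \<bar>x w\<bar>)"
      using \<alpha> by (intro add_mono) (simp_all add: abs_mult mult_left_mono sum_abs)
    finally have "l * \<bar>x v\<bar> / \<bar>x r\<bar> \<le>
        (\<alpha> * card (nbrs T v) * \<bar>x v\<bar> + (1 - \<alpha>) * (\<Sum>w\<in>nbrs T v. \<bar>x w\<bar>)) / \<bar>x r\<bar>"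
      using xr by (simp add: divide_right_mono)
    then show ?thesis
      by (simp add: z_def add_divide_distrib flip: sum_divide_distrib)
  qed
  have "subsolution ?V r par rank \<alpha> (1 - \<alpha>) (l - \<alpha>) z"
  proof
    show "0 \<le> \<alpha>" "0 < 1 - \<alpha>" "\<alpha> + (1 - \<alpha>) = 1" "1 - \<alpha> < l - \<alpha>"
      using \<alpha> l by simp_all
    show "0 \<le> z v" "z v \<le> 1" if "v \<in> ?V" for v
      using max[OF that] xr by (simp_all add: z_def)
    fix v assume v: "v \<in> ?V - {r}"
    have "l * z v \<le> \<alpha> * (card (ch v) + 1) * z v + (1 - \<alpha>) * ((\<Sum>w\<in>ch v. z w) + z (par v))"
      using z[of v] v by (simp add: card_nbrs sum_nbrs add.commute)
    moreover have "(\<Sum>w\<in>ch v. \<alpha> * z v + (1 - \<alpha>) * z w) =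
        card (ch v) * (\<alpha> * z v) + (1 - \<alpha>) * (\<Sum>w\<in>ch v. z w)"
      by (simp add: sum.distrib sum_distrib_left)
    \<comment> \<open>The share \<open>\<alpha> * z v\<close> of the edge to the parent moves to the
      left, which is why \<open>a\<close> is \<open>l - \<alpha>\<close>.\<close>
    ultimately show "(l - \<alpha>) * z v \<le> (1 - \<alpha>) * z (par v) + (\<Sum>w\<in>ch v. \<alpha> * z v + (1 - \<alpha>) * z w)"
      by (simp add: algebra_simps)
  qed
  moreover have "l \<le> (\<Sum>c\<in>ch r. \<alpha> + (1 - \<alpha>) * z c)"
  proof -
    have "z r = 1"
      using xr by (simp add: z_def)
    moreover have "(\<Sum>c\<in>ch r. \<alpha> + (1 - \<alpha>) * z c) = \<alpha> * card (ch r) + (1 - \<alpha>) * (\<Sum>c\<in>ch r. z c)"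
      by (simp add: sum.distrib sum_distrib_left)
    ultimately show ?thesis
      using z[OF r(1)] card_nbrs[OF r(1)] sum_nbrs[OF r(1)] by simp
  qed
  ultimately show thesis
    by (rule that[OF G])
qed

lemma simple_tree_dissociation_number:
  assumes T: "simple_tree T" and n: "3 \<le> card (pverts T)"
  shows "dissociation_number T < card (pverts T)"
    and "3 * (card (pverts T) - dissociation_number T) \<le> card (pverts T)"
proof -
  obtain r where r: "r \<in> pverts T"
    using n by (metis card.empty ex_in_conv not_numeral_le_zero)
  obtain par rank where tree: "rooted_tree (pverts T) r par rank"
    and arcs: "parcs T = tree_arcs (pverts T) r par \<union> (tree_arcs (pverts T) r par)\<inverse>"
    using simple_tree_rooted[OF T r] .
  interpret rooted_graph T r par rank
    unfolding rooted_graph_def rooted_graph_axioms_def using tree arcs by blast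
  show "dissociation_number T < card (pverts T)"
    using n by (rule dissociation_number_less)
  show "3 * (card (pverts T) - dissociation_number T) \<le> card (pverts T)"
    using card_cut_ge card_cut_le by linarith
qed

lemma eigenfunction_le_star:
  assumes T: "simple_tree T" and n: "card (pverts T) = n" "3 \<le> n" and \<alpha>: "0 \<le> \<alpha>" "\<alpha> < 1"
    and l: "1 < l" and x: "A_alpha_eigenfunction \<alpha> T l x"
  shows "l \<le> (real n - 1) * (\<alpha> + (1 - \<alpha>)\<^sup>2 / (l - \<alpha>))"
    and "l = (real n - 1) * (\<alpha> + (1 - \<alpha>)\<^sup>2 / (l - \<alpha>)) \<Longrightarrow> graph_isomorphic T (sdagger n (n - 1))"
proof -
  obtain r par rank z where G: "rooted_graph T r par rank"
    and sub: "subsolution (pverts T) r par rank \<alpha> (1 - \<alpha>) (l - \<alpha>) z"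
    and root: "l \<le> (\<Sum>c\<in>rooted_tree.ch (pverts T) r par r. \<alpha> + (1 - \<alpha>) * z c)"
    using eigenfunction_subsolution[OF T \<alpha> l x] .
  interpret rooted_graph T r par rank
    by (rule G)
  interpret subsolution "pverts T" r par rank \<alpha> "1 - \<alpha>" "l - \<alpha>" z
    by (rule sub)
  have root': "\<alpha> + (l - \<alpha>) \<le> (\<Sum>c\<in>ch r. \<alpha> + (1 - \<alpha>) * z c)"
    using root by simp
  show "l \<le> (real n - 1) * (\<alpha> + (1 - \<alpha>)\<^sup>2 / (l - \<alpha>))"
    using star_bound(1)[OF root'] unfolding A_def n(1) by simp
  assume "l = (real n - 1) * (\<alpha> + (1 - \<alpha>)\<^sup>2 / (l - \<alpha>))"
  then have "\<forall>c\<in>ch r. ch c = {}"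
    using star_bound(2)[OF root'] unfolding A_def n(1) by simp
  then show "graph_isomorphic T (sdagger n (n - 1))"
    using n by (intro isomorphic_sdagger[of "{}"]) auto
qed

lemma eigenfunction_le_cherry:
  assumes T: "simple_tree T" and n: "card (pverts T) = n" "3 \<le> n" and \<alpha>: "0 \<le> \<alpha>" "\<alpha> < 1"
    and l: "\<alpha> < l" and x: "A_alpha_eigenfunction \<alpha> T l x" and \<tau>: "dissociation_number T = \<tau>"
    and A: "A = \<alpha> + (1 - \<alpha>)\<^sup>2 / (l - \<alpha>)" and N: "N = l - \<alpha> - 2 * A" "1 - \<alpha> \<le> N"
    and H: "H = (1 - \<alpha>)\<^sup>2 / N"
  shows "l \<le> (real n - 1) * A - (real n - real \<tau> - 1) * (3 * A - \<alpha> - H)"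
    and "l = (real n - 1) * A - (real n - real \<tau> - 1) * (3 * A - \<alpha> - H) \<Longrightarrow>
      graph_isomorphic T (sdagger n \<tau>)"
proof -
  have "0 < A"
    unfolding A using \<alpha> l by (intro add_nonneg_pos) simp_all
  then have l1: "1 < l"
    using N by linarith
  obtain r par rank z where G: "rooted_graph T r par rank"
    and sub: "subsolution (pverts T) r par rank \<alpha> (1 - \<alpha>) (l - \<alpha>) z"
    and root: "l \<le> (\<Sum>c\<in>rooted_tree.ch (pverts T) r par r. \<alpha> + (1 - \<alpha>) * z c)"
    using eigenfunction_subsolution[OF T \<alpha> l1 x] .
  interpret rooted_graph T r par rank
    by (rule G)
  interpret S: subsolution "pverts T" r par rank \<alpha> "1 - \<alpha>" "l - \<alpha>" z
    by (rule sub)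
  have SA: "S.A = A"
    unfolding S.A_def A ..
  interpret S: heavy_subsolution "pverts T" r par rank \<alpha> "1 - \<alpha>" "l - \<alpha>" z
    by unfold_locales (simp add: SA N(1)[symmetric] N(2))
  have SH: "S.H = H"
    unfolding S.H_def S.N_def SA H N(1) ..
  have \<tau>_less: "\<tau> < n"
    using simple_tree_dissociation_number(1)[OF T] n \<tau> by simp
  then have k: "n - \<tau> - 1 + 1 \<le> card {v \<in> pverts T. cut v}"
    using card_cut_ge n(1) \<tau> by simp
  have real_k: "real (n - \<tau> - 1) = real n - real \<tau> - 1"
    using \<tau>_less by (simp add: of_nat_diff)
  have root': "\<alpha> + (l - \<alpha>) \<le> (\<Sum>c\<in>ch r. \<alpha> + (1 - \<alpha>) * z c)"
    using root by simp
  note bound = S.cherry_bound[OF root' k, unfolded SA SH real_k n(1)]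
  show "l \<le> (real n - 1) * A - (real n - real \<tau> - 1) * (3 * A - \<alpha> - H)"
    using bound(1) by simp
  assume "l = (real n - 1) * A - (real n - real \<tau> - 1) * (3 * A - \<alpha> - H)"
  then have "\<alpha> + (l - \<alpha>) = (real n - 1) * A - (real n - real \<tau> - 1) * (3 * A - \<alpha> - H)"
    by simp
  from bound(2)[OF this] have shape: "\<And>c. c \<in> ch r \<Longrightarrow> if cut c then card (ch c) = 2 \<and> (\<forall>w\<in>ch c. ch w = {}) else ch c = {}"
    and card: "card {v \<in> pverts T - {r}. cut v} = n - \<tau> - 1"
    by blast+
  have shape_cut: "card (ch c) = 2 \<and> (\<forall>w\<in>ch c. ch w = {})" if "c \<in> ch r" "cut c" for c
    using shape[OF that(1)] unfolding if_P[OF that(2)] .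
  have shape_uncut: "ch c = {}" if "c \<in> ch r" "\<not> cut c" for c
    using shape[OF that(1)] unfolding if_not_P[OF that(2)] .
  \<comment> \<open>By the shape of the branches a vertex other than \<open>r\<close> is a child of
    \<open>r\<close> or has no children, and a vertex without children is never cut. So the cuts
    below the root are exactly the cherry centres, and their number is known.\<close>
  have "{v \<in> pverts T - {r}. cut v} = {c \<in> ch r. cut c}"
  proof (intro equalityI subsetI)
    fix v assume "v \<in> {c \<in> ch r. cut c}"
    then show "v \<in> {v \<in> pverts T - {r}. cut v}"
      using chD by auto
  next
    have "v \<in> ch r \<or> ch v = {}" if "v \<in> pverts T - {r}" for v
      using that
    proof (induction "rank v" arbitrary: v rule: less_induct)
      case less
      have v: "v \<in> ch (par v)"
        using less.prems by (simp add: ch_def)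
      show ?case
      proof (cases "par v = r")
        case True
        then show ?thesis
          using v by simp
      next
        case False
        then have "par v \<in> pverts T - {r}"
          using par_in_V[OF less.prems] by simp
        from less.hyps[OF rank_par_less[OF less.prems] this] show ?thesis
          using v shape_cut shape_uncut by blast
      qed
    qed
    then show "v \<in> {c \<in> ch r. cut c}" if "v \<in> {v \<in> pverts T - {r}. cut v}" for v
      using that uncut_leaf by blast
  qed
  then show "graph_isomorphic T (sdagger n \<tau>)"
  proof (intro isomorphic_sdagger[of "{c \<in> ch r. cut c}"])
    assume eq: "{v \<in> pverts T - {r}. cut v} = {c \<in> ch r. cut c}"
    show "card {c \<in> ch r. cut c} = n - \<tau> - 1"
      using card unfolding eq .
    show "2 * n \<le> 3 * \<tau> + 2"
      using simple_tree_dissociation_number(2)[OF T] n \<tau> \<tau>_less by simp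
    show "ch w = {}" if "c \<in> {c \<in> ch r. cut c}" "w \<in> ch c" for c w
      using shape_cut that by blast
    show "ch c = {}" if "c \<in> ch r - {c \<in> ch r. cut c}" for c
      using shape_uncut that by blast
    show "card (ch c) = 2" if "c \<in> {c \<in> ch r. cut c}" for c
      using shape_cut that by blast
  qed (use n(1) \<tau>_less in auto)
qed

lemma star_quadratic:
  fixes \<alpha> l m :: real
  assumes "\<alpha> < l"
  shows "(l - \<alpha> * m) * (l - \<alpha>) - m * (1 - \<alpha>)\<^sup>2 = (l - \<alpha>) * (l - m * (\<alpha> + (1 - \<alpha>)\<^sup>2 / (l - \<alpha>)))"
  using assms by (simp add: field_simps)

lemma theta_star:
  assumes n: "3 \<le> n" and \<alpha>: "0 \<le> \<alpha>" "\<alpha> < 1"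
  obtains \<rho> where "1 < \<rho>" "\<rho> \<le> theta \<alpha> n (n - 1)"
    "\<rho> = (real n - 1) * (\<alpha> + (1 - \<alpha>)\<^sup>2 / (\<rho> - \<alpha>))"
    "\<And>l. 1 < l \<Longrightarrow> l \<le> (real n - 1) * (\<alpha> + (1 - \<alpha>)\<^sup>2 / (l - \<alpha>)) \<Longrightarrow> l \<le> \<rho>"
    "\<not> (n = 3 \<and> 0 < \<alpha>) \<Longrightarrow> theta \<alpha> n (n - 1) = \<rho>"
proof -
  define R where "R x = (x - \<alpha> * (real n - 1)) * (x - \<alpha>) - (real n - 1) * (1 - \<alpha>)\<^sup>2" for x
  obtain \<rho> where \<rho>: "1 < \<rho>" "R \<rho> = 0" "\<And>x. R x \<le> 0 \<Longrightarrow> x \<le> \<rho>"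
    using star_root[OF \<alpha>, of "real n"] n unfolding R_def by (metis of_nat_numeral of_nat_le_iff)
  have real_n: "real (n - 1) = real n - 1"
    using n by (simp add: of_nat_diff)
  define Q where "Q x = (x - 3 * \<alpha>) * (x - \<alpha>) - 2 * (1 - \<alpha>)\<^sup>2" for x
  have P: "P_alpha \<alpha> (real n) (real (n - 1)) x = R x * Q x" for x
    unfolding real_n R_def Q_def by (rule P_alpha_eq_star[OF refl])
  have le: "\<rho> \<le> theta \<alpha> n (n - 1)" and root: "R (theta \<alpha> n (n - 1)) * Q (theta \<alpha> n (n - 1)) = 0"
    using theta_ge[of \<alpha> n "n - 1" \<rho>, unfolded P] \<rho>(2) by simp_all
  have R_eq: "R l = (l - \<alpha>) * (l - (real n - 1) * (\<alpha> + (1 - \<alpha>)\<^sup>2 / (l - \<alpha>)))" if "\<alpha> < l" for l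
    unfolding R_def using that by (rule star_quadratic)
  show thesis
  proof (rule that)
    show "\<rho> = (real n - 1) * (\<alpha> + (1 - \<alpha>)\<^sup>2 / (\<rho> - \<alpha>))"
      using R_eq[of \<rho>] \<rho>(1,2) \<alpha> by simp
    show "l \<le> \<rho>" if "1 < l" "l \<le> (real n - 1) * (\<alpha> + (1 - \<alpha>)\<^sup>2 / (l - \<alpha>))" for l
      using R_eq[of l] that \<alpha> by (intro \<rho>(3)) (simp add: mult_le_0_iff)
    assume n3: "\<not> (n = 3 \<and> 0 < \<alpha>)"
    let ?t = "theta \<alpha> n (n - 1)"
    have "R ?t \<le> 0" if "Q ?t = 0"
    proof -
      \<comment> \<open>The subtracted terms are nonnegative for \<open>n \<ge> 4\<close>. For
        \<open>n = 3\<close> the factor \<open>real n - 4\<close> is negative, and the first term is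
        harmless only if \<open>\<alpha> = 0\<close>; this is the origin of the exception.\<close>
      have "R ?t = Q ?t - (\<alpha> * (real n - 4) * (?t - \<alpha>) + (real n - 3) * (1 - \<alpha>)\<^sup>2)"
        unfolding R_def Q_def by (simp add: algebra_simps)
      moreover have "0 \<le> \<alpha> * (real n - 4) * (?t - \<alpha>)"
      proof (cases "n = 3")
        case True
        then show ?thesis
          using n3 \<alpha> by simp
      next
        case False
        then show ?thesis
          using n \<alpha> le \<rho>(1) by simp
      qed
      moreover have "0 \<le> (real n - 3) * (1 - \<alpha>)\<^sup>2"
        using n by simp
      ultimately show ?thesis
        using that by linarith
    qed
    then have "R ?t \<le> 0"
      using root by auto
    then show "?t = \<rho>"
      using \<rho>(3) le by (simp add: antisym)
  qed (use \<rho>(1) le in auto)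
qed

text \<open>At \<open>\<alpha> + p\<close> the cherry block vanishes and only the negative coupling
  term of the quartic remains, so \<open>theta\<close> lies beyond the pole of \<open>H\<close>. For
  \<open>l \<ge> theta\<close> this gives \<open>N > 0\<close>, and \<open>P_alpha_eq\<close>
  translates the sign of the quartic.\<close>

lemma theta_cherry:
  assumes n: "\<tau> + 1 < n" "2 * n \<le> 3 * \<tau>" and \<alpha>: "0 \<le> \<alpha>" "\<alpha> < 1"
  shows "\<alpha> < theta \<alpha> n \<tau>"
    and "\<And>l A N H. theta \<alpha> n \<tau> \<le> l \<Longrightarrow> A = \<alpha> + (1 - \<alpha>)\<^sup>2 / (l - \<alpha>) \<Longrightarrow> N = l - \<alpha> - 2 * A \<Longrightarrow>
      H = (1 - \<alpha>)\<^sup>2 / N \<Longrightarrow> 1 - \<alpha> \<le> N \<and>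
      (real n - 1) * A - (real n - real \<tau> - 1) * (3 * A - \<alpha> - H) \<le> l \<and>
      (l = (real n - 1) * A - (real n - real \<tau> - 1) * (3 * A - \<alpha> - H) \<longleftrightarrow> l = theta \<alpha> n \<tau>)"
proof -
  define k where "k = real n - real \<tau> - 1"
  let ?P = "P_alpha \<alpha> (real n) (real \<tau>)"
  have k: "1 \<le> k" and c: "2 \<le> real n - 1 - 3 * k"
  proof -
    have "real (2 * n) \<le> real (3 * \<tau>)" "real (\<tau> + 2) \<le> real n"
      using n unfolding of_nat_le_iff by simp_all
    then show "1 \<le> k" "2 \<le> real n - 1 - 3 * k"
      by (simp_all add: k_def)
  qed
  have \<beta>: "0 < 1 - \<alpha>"
    using \<alpha> by simp
  obtain p where p: "0 < p" "p\<^sup>2 - 2 * \<alpha> * p - 2 * (1 - \<alpha>)\<^sup>2 = 0"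
    "\<forall>a>p. 0 < a - 2 * (\<alpha> + (1 - \<alpha>)\<^sup>2 / a)"
    using branch_pole[OF \<alpha>(1) \<beta>] .
  have "(\<alpha> + p - 3 * \<alpha>) * p - 2 * (1 - \<alpha>)\<^sup>2 = 0"
    using p(2) by (simp add: power2_eq_square algebra_simps)
  then have "?P (\<alpha> + p) = - (k * (1 - \<alpha>)\<^sup>2 * p\<^sup>2)"
    using P_alpha_factor[OF refl, of p "\<alpha> + p" \<alpha> k "real n" "real \<tau>"] by (simp add: k_def)
  also have "\<dots> < 0"
    using k \<beta> p(1) by simp
  finally have neg: "?P (\<alpha> + p) < 0" .
  note theta = theta_ge[OF less_imp_le[OF neg]]
  have pole: "\<alpha> + p < theta \<alpha> n \<tau>"
    using theta neg by (metis less_irrefl order_le_less)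
  then show "\<alpha> < theta \<alpha> n \<tau>"
    using p(1) by simp
  fix l A N H
  assume l: "theta \<alpha> n \<tau> \<le> l" and A: "A = \<alpha> + (1 - \<alpha>)\<^sup>2 / (l - \<alpha>)" and N: "N = l - \<alpha> - 2 * A"
    and H: "H = (1 - \<alpha>)\<^sup>2 / N"
  let ?\<Phi> = "(real n - 1) * A - (real n - real \<tau> - 1) * (3 * A - \<alpha> - H)"
  have a: "p < l - \<alpha>"
    using pole l by simp
  then have a_pos: "0 < l - \<alpha>"
    using p(1) by simp
  have N_pos: "0 < N"
    unfolding N A using p(3) a by blast
  have P: "?P l = (l - \<alpha>)\<^sup>2 * N * (l - ?\<Phi>)"
    using P_alpha_eq[OF refl _ refl A N _ H, of "real n" "real \<tau>"] a_pos N_pos by simp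
  have factor: "0 < (l - \<alpha>)\<^sup>2 * N"
    using a_pos N_pos by simp
  \<comment> \<open>A negative value at \<open>l\<close> would put a zero of the quartic above
    \<open>l\<close>, hence above \<open>theta\<close>.\<close>
  have "0 \<le> ?P l"
    using theta(2) theta_ge(1)[of \<alpha> n \<tau> l] l by (metis linear order.antisym)
  then have le: "?\<Phi> \<le> l"
    unfolding P using factor by (simp add: zero_le_mult_iff)
  moreover have "1 - \<alpha> \<le> N"
  proof (rule branch_weight_ge[OF \<alpha>(1) \<beta> a_pos A N N_pos H k c])
    show "(real n - 1 - 3 * k) * A + k * (\<alpha> + H) \<le> \<alpha> + (l - \<alpha>)"
      using le by (simp add: k_def algebra_simps)
  qed
  moreover have "l = ?\<Phi> \<longleftrightarrow> l = theta \<alpha> n \<tau>"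
  proof
    assume "l = ?\<Phi>"
    then have "?P l = 0"
      unfolding P by simp
    then show "l = theta \<alpha> n \<tau>"
      using theta_ge(1)[of \<alpha> n \<tau> l] l by simp
  next
    assume "l = theta \<alpha> n \<tau>"
    then have "?P l = 0"
      using theta(2) by simp
    then show "l = ?\<Phi>"
      unfolding P using factor by auto
  qed
  ultimately show "1 - \<alpha> \<le> N \<and> ?\<Phi> \<le> l \<and> (l = ?\<Phi> \<longleftrightarrow> l = theta \<alpha> n \<tau>)"
    by blast
qed

text \<open>The case \<open>\<tau> = n - 1\<close> stands apart because
  \<open>branch_weight_ge\<close> draws \<open>\<beta> \<le> N\<close> from the presence of a cherry
  in the extremal tree, and the star has none.\<close>

lemma eigenfunction_le_theta:
  assumes T: "simple_tree T" and n: "card (pverts T) = n" "3 \<le> n" and \<tau>: "dissociation_number T = \<tau>"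
    and \<alpha>: "0 \<le> \<alpha>" "\<alpha> < 1" and x: "A_alpha_eigenfunction \<alpha> T l x"
  shows "l \<le> theta \<alpha> n \<tau>" and "l = theta \<alpha> n \<tau> \<Longrightarrow> graph_isomorphic T (sdagger n \<tau>)"
proof -
  have \<tau>_less: "\<tau> < n" and \<tau>_ge: "2 * n \<le> 3 * \<tau>"
    using simple_tree_dissociation_number[OF T] n \<tau> by simp_all
  have "l \<le> theta \<alpha> n \<tau> \<and> (l = theta \<alpha> n \<tau> \<longrightarrow> graph_isomorphic T (sdagger n \<tau>))"
  proof (cases "\<tau> + 1 < n")
    case False
    with \<tau>_less have \<tau>_eq: "\<tau> = n - 1"
      by simp
    obtain \<rho> where \<rho>: "1 < \<rho>" "\<rho> \<le> theta \<alpha> n \<tau>" "\<rho> = (real n - 1) * (\<alpha> + (1 - \<alpha>)\<^sup>2 / (\<rho> - \<alpha>))"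
      "\<And>l. 1 < l \<Longrightarrow> l \<le> (real n - 1) * (\<alpha> + (1 - \<alpha>)\<^sup>2 / (l - \<alpha>)) \<Longrightarrow> l \<le> \<rho>"
      using theta_star[OF n(2) \<alpha>] unfolding \<tau>_eq by metis
    have le: "l \<le> \<rho>"
    proof (cases "1 < l")
      case True
      then show ?thesis
        using \<rho>(4) eigenfunction_le_star(1)[OF T n \<alpha> True x] by blast
    qed (use \<rho>(1) in simp)
    moreover have "graph_isomorphic T (sdagger n \<tau>)" if "l = theta \<alpha> n \<tau>"
    proof -
      have "l = \<rho>"
        using that le \<rho>(2) by simp
      then show ?thesis
        using eigenfunction_le_star(2)[OF T n \<alpha> _ x] \<rho>(1,3) unfolding \<tau>_eq by blast
    qed
    ultimately show ?thesis
      using \<rho>(2) by auto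
  next
    case True
    show ?thesis
    proof (cases "theta \<alpha> n \<tau> \<le> l")
      case l: True
      have l': "\<alpha> < l"
        using theta_cherry(1)[OF True \<tau>_ge \<alpha>] l by simp
      note theta = theta_cherry(2)[OF True \<tau>_ge \<alpha> l refl refl refl]
      note bound = eigenfunction_le_cherry[OF T n \<alpha> l' x \<tau> refl refl theta[THEN conjunct1] refl]
      show ?thesis
        using theta bound by (metis antisym order_refl)
    qed simp
  qed
  then show "l \<le> theta \<alpha> n \<tau>" and "l = theta \<alpha> n \<tau> \<Longrightarrow> graph_isomorphic T (sdagger n \<tau>)"
    by blast+
qed

text \<open>Needed for the converse of the equality statement. The equation at the centre of
  \<open>sdagger n \<tau>\<close> is the equality case of the bound, taken at
  \<open>l = theta\<close>.\<close>

lemma theta_eigenfunction_sdagger: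
  assumes n: "3 \<le> n" "\<tau> < n" "2 * n \<le> 3 * \<tau>" and \<alpha>: "0 \<le> \<alpha>" "\<alpha> < 1" and n3: "\<not> (n = 3 \<and> 0 < \<alpha>)"
  shows "\<exists>x. A_alpha_eigenfunction \<alpha> (sdagger n \<tau>) (theta \<alpha> n \<tau>) x"
proof -
  define a where "a = theta \<alpha> n \<tau> - \<alpha>"
  define A where "A = \<alpha> + (1 - \<alpha>)\<^sup>2 / a"
  define N where "N = a - 2 * A"
  define H where "H = (1 - \<alpha>)\<^sup>2 / N"
  have "0 < a \<and> (\<tau> + 1 < n \<longrightarrow> 0 < N) \<and>
    \<alpha> + a = (real n - 1) * A - (real n - real \<tau> - 1) * (3 * A - \<alpha> - H)"
  proof (cases "\<tau> + 1 < n")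
    case False
    with n(2) have \<tau>: "\<tau> = n - 1"
      by simp
    have "1 < theta \<alpha> n \<tau> \<and> theta \<alpha> n \<tau> = (real n - 1) * (\<alpha> + (1 - \<alpha>)\<^sup>2 / (theta \<alpha> n \<tau> - \<alpha>))"
      using theta_star[OF n(1) \<alpha>] n3 unfolding \<tau> by metis
    moreover have "real n - real \<tau> - 1 = 0"
      using n(1) by (simp add: \<tau> of_nat_diff)
    ultimately show ?thesis
      using False \<alpha> by (simp add: a_def A_def)
  next
    case True
    show ?thesis
      using theta_cherry(1)[OF True n(3) \<alpha>] \<alpha>
        theta_cherry(2)[OF True n(3) \<alpha> order_refl A_def[unfolded a_def] N_def[unfolded a_def] H_def]
      by (simp add: a_def)
  qed
  then show ?thesis
    using sdagger_eigenfunction[OF n(2) _ _ A_def N_def H_def] n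
    by (simp add: a_def)
qed

theorem theorem1p3:
  fixes T :: "'a pair_pre_digraph" and n \<tau> :: nat and \<alpha> :: real
  assumes "3 \<le> n" and "0 \<le> \<alpha>" and "\<alpha> < 1"
    and "simple_tree T" and "graph_order T = n" and "dissociation_number T = \<tau>"
    and "\<And>T' :: 'a pair_pre_digraph.
           simple_tree T' \<Longrightarrow> graph_order T' = n \<Longrightarrow> dissociation_number T' = \<tau> \<Longrightarrow>
           A_alpha_index \<alpha> T' \<le> A_alpha_index \<alpha> T"
  shows "A_alpha_index \<alpha> T \<le> theta \<alpha> n \<tau> \<and>
    (\<not> (n = 3 \<and> 0 < \<alpha>) \<longrightarrow>
      (A_alpha_index \<alpha> T = theta \<alpha> n \<tau> \<longleftrightarrow> graph_isomorphic T (sdagger n \<tau>)))"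
proof -
  note T = assms(4)
  note fin = simple_treeD(1)[OF T] and arcs = simple_treeD(2)[OF T]
  have n: "card (pverts T) = n"
    using assms(5) by (simp add: graph_order_def)
  then have ne: "pverts T \<noteq> {}"
    using assms(1) by auto
  have "\<tau> < n" "2 * n \<le> 3 * \<tau>"
    using simple_tree_dissociation_number[OF T] n assms(1,6) by simp_all
  note theta = theta_eigenfunction_sdagger[OF assms(1) this assms(2,3)]
  note index = A_alpha_index[OF fin ne simple_treeD(3)[OF T], of \<alpha>]
  obtain x where "A_alpha_eigenfunction \<alpha> T (A_alpha_index \<alpha> T) x"
    using index(1) eigenvalue_A_alpha_iff[OF fin arcs] by blast
  note bound = eigenfunction_le_theta[OF T n assms(1,6,2,3) this]
  \<comment> \<open>The isomorphism carries the eigenfunction of the extremal tree over to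
    \<open>T\<close>, so \<open>theta\<close> is one of the eigenvalues of \<open>T\<close>.\<close>
  have "theta \<alpha> n \<tau> \<le> A_alpha_index \<alpha> T"
    if "\<not> (n = 3 \<and> 0 < \<alpha>)" "graph_isomorphic T (sdagger n \<tau>)"
    using theta[OF that(1)] A_alpha_eigenfunction_iso[OF that(2) arcs] index(2)
      eigenvalue_A_alpha_iff[OF fin arcs] by blast
  with bound show ?thesis
    by (metis antisym)
qed

end
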